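(* Let $G$ be a countable infinite discrete amenable group acting continuously on a compact metric space $(X,d)$, and let $\{F_n\}_{n=1}^{\infty}$ be a Følner sequence in $G$ with $|F_n|$ increasing and satisfying $\lim_{n\to\infty}\frac{|F_n|}{\log n}=\infty$. Let $H$ be a non-empty analytic subset of $X$ and $\Phi:X\to\mathbb{R}$ a positive continuous function. Then $$\begin{aligned} \dim_H^{\widetilde{BSP}}(\{F_n\}_{n=1}^{\infty},\Phi)&=\sup\{\overline{P}_{\mu}^{\widetilde{BK}}(\{F_n\}_{n=1}^{\infty},\Phi):\mu\in M(X),\ \mu(H)=1\}\\ &=\sup\{\dim_{\mu}^{\widetilde{BSP}}(\{F_n\}_{n=1}^{\infty},\Phi):\mu\in M(X),\ \mu(H)=1\}\\ &=\sup\{\dim_{\mu}^{\widetilde{KP}}(\{F_n\}_{n=1}^{\infty},\Phi):\mu\in M(X),\ \mu(H)=1\}. \end{aligned}$$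
   Context: A Følner sequence in $G$ is a sequence of non-empty finite subsets $F_n\subset G$ with $\lim_{n\to\infty}|F_n\triangle gF_n|/|F_n|=0$ for every $g\in G$. $M(X)$ is the set of Borel probability measures on $X$; an analytic set is measurable for the completion of every $\mu\in M(X)$, and $\mu(H)$ is understood in this sense. For finite $F\subset G$: $d_F(x,y)=\max_{g\in F}d(gx,gy)$, $B_F(x,\epsilon)=\{y:d_F(x,y)<\epsilon\}$, $\overline B_F(x,\epsilon)=\{y:d_F(x,y)\le\epsilon\}$, and $\Phi_F(x)=\sum_{g\in F}\Phi(gx)$. All quantities take values in $[0,\infty]$; in critical values below $s$ ranges over $s>0$, with $\sup\emptyset=0$, $\inf\emptyset=\infty$. BS packing dimension of a set. For $H\subset X$, $\epsilon>0$, $N\in\mathbb{N}$, $s>0$ let $$L^{s}_{N,\epsilon}(H,\{F_n\},\Phi)=\sup\sum_{i\in I}\exp\Big(-s\sup_{y\in\overline B_{F_{n_i}}(x_i,\epsilon)}\Phi_{F_{n_i}}(y)\Big),$$ the supremum over all finite or countable pairwise disjoint families $\{\overline B_{F_{n_i}}(x_i,\epsilon)\}_{i\in I}$ with $n_i\ge N$, $x_i\in H$. Let $L^s_\epsilon(H,\{F_n\},\Phi)=\lim_{N\to\infty}L^s_{N,\epsilon}(H,\{F_n\},\Phi)$, $\mathscr L^s_\epsilon(H,\{F_n\},\Phi)=\inf\{\sum_{i=1}^\infty L^s_\epsilon(H_i,\{F_n\},\Phi):H\subset\bigcup_{i=1}^\infty H_i\}$, $\mathscr L_\epsilon(H,\{F_n\},\Phi)=\sup\{s:\mathscr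 L^s_\epsilon=\infty\}=\inf\{s:\mathscr L^s_\epsilon=0\}$, and $\dim_H^{\widetilde{BSP}}(\{F_n\},\Phi)=\lim_{\epsilon\to0}\mathscr L_\epsilon(H,\{F_n\},\Phi)$. Let $\widetilde L^s_{N,\epsilon}$, $\widetilde L^s_\epsilon$, $\widetilde{\mathscr L}^s_\epsilon$, $\widetilde{\mathscr L}_\epsilon$ be defined in the same way with $\sup_{y\in\overline B_{F_{n_i}}(x_i,\epsilon)}\Phi_{F_{n_i}}(y)$ replaced by $\Phi_{F_{n_i}}(x_i)$. Upper measure-theoretic BS dimension of $\mu$: $$\overline{P}_{\mu}^{\widetilde{BK}}(\{F_n\},\Phi)=\int\lim_{\epsilon\to0}\limsup_{n\to\infty}\frac{-\log\mu(B_{F_n}(x,\epsilon))}{\Phi_{F_n}(x)}\,d\mu(x).$$ BS packing dimension of $\mu$: $\dim_\mu^{\widetilde{BSP}}(\{F_n\},\Phi)=\lim_{\epsilon\to0}\lim_{\delta\to0}\inf\{\widetilde{\mathscr L}_\epsilon(Z,\{F_n\},\Phi):Z\subset X\text{ Borel},\ \mu(Z)\ge1-\delta\}$. BS packing dimension of $\mu$ in the sense of Katok: for $\delta\in(0,1)$ let $\Xi^s_\epsilon(\mu,\{F_n\},\Phi,\delta)=\inf\{\sum_{i=1}^\infty\widetilde L^s_\epsilon(H_i,\{F_n\},\Phi):\mu(\bigcup_{i=1}^\infty H_i)\ge1-\delta\}$ (over countable families of subsets of $X$ whose union is Borel), $\Xi_\epsilon(\mu,\{F_n\},\Phi,\delta)=\sup\{s:\Xi^s_\epsilon(\mu,\{F_n\},\Phi,\delta)=+\infty\}$,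 and $\dim_\mu^{\widetilde{KP}}(\{F_n\},\Phi)=\lim_{\epsilon\to0}\lim_{\delta\to0}\Xi_\epsilon(\mu,\{F_n\},\Phi,\delta)$. *)

theory Defs
  imports "HOL-Analysis.Analysis" "HOL-Probability.Probability_Measure"
    "HOL-Algebra.Group_Action"
begin

section \<open>Groups, Folner sequences, analytic sets\<close>

text \<open>Sequences are indexed by \<open>n \<ge> 1\<close>; the value \<open>F 0\<close> is unconstrained and is
  irrelevant to everything below, which only involves limits along \<open>n\<close>.\<close>

definition folner_sequence :: "('g, 'b) monoid_scheme \<Rightarrow> (nat \<Rightarrow> 'g set) \<Rightarrow> bool" where
  "folner_sequence G F \<longleftrightarrow>
     (\<forall>n\<ge>1. F n \<noteq> {} \<and> finite (F n) \<and> F n \<subseteq> carrier G) \<and>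
     (\<forall>g\<in>carrier G.
        (\<lambda>n. real (card (sym_diff (F n) (g <#\<^bsub>G\<^esub> F n))) / real (card (F n))) \<longlonglongrightarrow> 0)"

text \<open>Folner's characterization of amenability; it is the usual definition for
  countable discrete groups, the only ones to which it is applied.\<close>

definition amenable_group :: "('g, 'b) monoid_scheme \<Rightarrow> bool" where
  "amenable_group G \<longleftrightarrow> group G \<and> (\<exists>F. folner_sequence G F)"

text \<open>The group is discrete, so the action is continuous iff every group element acts
  continuously.\<close>

definition continuous_group_action ::
    "('g, 'b) monoid_scheme \<Rightarrow> ('g \<Rightarrow> 'x::topological_space \<Rightarrow> 'x) \<Rightarrow> bool" where
  "continuous_group_action G \<phi> \<longleftrightarrow>
     group_action G UNIV \<phi> \<and> (\<forall>g\<in>carrier G. continuous_on UNIV (\<phi> g))"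

text \<open>Analytic sets are the continuous images of the Baire space
  (\<open>nat \<Rightarrow> nat\<close> with the product topology), together with the empty set.\<close>

definition analytic_set :: "'x::topological_space set \<Rightarrow> bool" where
  "analytic_set A \<longleftrightarrow>
     A = {} \<or> (\<exists>f :: (nat \<Rightarrow> nat) \<Rightarrow> 'x. continuous_on UNIV f \<and> range f = A)"

definition borel_prob_measures :: "'x::topological_space measure set" where
  "borel_prob_measures = {\<mu>. prob_space \<mu> \<and> sets \<mu> = sets borel}"

text \<open>An outright non-measurable set has \<open>emeasure\<close> zero, so the condition below includes
  measurability of \<open>H\<close> for the completion of \<open>\<mu>\<close>.\<close>

definition prob_measures_on :: "'x::topological_space set \<Rightarrow> 'x measure set" where
  "prob_measures_on H = {\<mu> \<in> borel_prob_measures. emeasure (completion \<mu>) H = 1}"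


section \<open>Bowen balls and orbit sums\<close>

definition bowen_dist ::
    "('g \<Rightarrow> 'x::metric_space \<Rightarrow> 'x) \<Rightarrow> 'g set \<Rightarrow> 'x \<Rightarrow> 'x \<Rightarrow> real" where
  "bowen_dist \<phi> F x y = Max ((\<lambda>g. dist (\<phi> g x) (\<phi> g y)) ` F)"

definition bowen_ball ::
    "('g \<Rightarrow> 'x::metric_space \<Rightarrow> 'x) \<Rightarrow> 'g set \<Rightarrow> 'x \<Rightarrow> real \<Rightarrow> 'x set" where
  "bowen_ball \<phi> F x \<epsilon> = {y. bowen_dist \<phi> F x y < \<epsilon>}"

definition bowen_cball ::
    "('g \<Rightarrow> 'x::metric_space \<Rightarrow> 'x) \<Rightarrow> 'g set \<Rightarrow> 'x \<Rightarrow> real \<Rightarrow> 'x set" where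
  "bowen_cball \<phi> F x \<epsilon> = {y. bowen_dist \<phi> F x y \<le> \<epsilon>}"

definition orbit_sum :: "('g \<Rightarrow> 'x \<Rightarrow> 'x) \<Rightarrow> ('x \<Rightarrow> real) \<Rightarrow> 'g set \<Rightarrow> 'x \<Rightarrow> real" where
  "orbit_sum \<phi> \<Phi> F x = (\<Sum>g\<in>F. \<Phi> (\<phi> g x))"


section \<open>Packing quantities of sets\<close>

text \<open>The quantities with and without tilde differ only in the weight of a closed
  Bowen ball, which is therefore a parameter \<open>w \<epsilon> n x\<close>: \<open>sup_weight\<close> gives the plain
  and \<open>center_weight\<close> the tilde version.\<close>

definition sup_weight ::
    "('g \<Rightarrow> 'x::metric_space \<Rightarrow> 'x) \<Rightarrow> (nat \<Rightarrow> 'g set) \<Rightarrow> ('x \<Rightarrow> real) \<Rightarrow> real \<Rightarrow> nat \<Rightarrow> 'x \<Rightarrow> real" where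
  "sup_weight \<phi> F \<Phi> \<epsilon> n x = (SUP y\<in>bowen_cball \<phi> (F n) x \<epsilon>. orbit_sum \<phi> \<Phi> (F n) y)"

definition center_weight ::
    "('g \<Rightarrow> 'x::metric_space \<Rightarrow> 'x) \<Rightarrow> (nat \<Rightarrow> 'g set) \<Rightarrow> ('x \<Rightarrow> real) \<Rightarrow> real \<Rightarrow> nat \<Rightarrow> 'x \<Rightarrow> real" where
  "center_weight \<phi> F \<Phi> \<epsilon> n x = orbit_sum \<phi> \<Phi> (F n) x"

text \<open>Countable families are indexed by sets \<open>I\<close> of natural numbers.\<close>

definition packing_pre ::
    "('g \<Rightarrow> 'x::metric_space \<Rightarrow> 'x) \<Rightarrow> (nat \<Rightarrow> 'g set) \<Rightarrow> (real \<Rightarrow> nat \<Rightarrow> 'x \<Rightarrow> real)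
      \<Rightarrow> real \<Rightarrow> nat \<Rightarrow> real \<Rightarrow> 'x set \<Rightarrow> ennreal" where
  "packing_pre \<phi> F w s N \<epsilon> H =
     Sup {(\<Sum>\<^sub>\<infinity>i\<in>I. ennreal (exp (- s * w \<epsilon> (n i) (x i)))) | (I :: nat set) n x.
       (\<forall>i\<in>I. n i \<ge> N \<and> x i \<in> H) \<and>
       disjoint_family_on (\<lambda>i. bowen_cball \<phi> (F (n i)) (x i) \<epsilon>) I}"

definition packing_lim ::
    "('g \<Rightarrow> 'x::metric_space \<Rightarrow> 'x) \<Rightarrow> (nat \<Rightarrow> 'g set) \<Rightarrow> (real \<Rightarrow> nat \<Rightarrow> 'x \<Rightarrow> real)
      \<Rightarrow> real \<Rightarrow> real \<Rightarrow> 'x set \<Rightarrow> ennreal" where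
  "packing_lim \<phi> F w s \<epsilon> H = lim (\<lambda>N. packing_pre \<phi> F w s N \<epsilon> H)"

definition packing_outer ::
    "('g \<Rightarrow> 'x::metric_space \<Rightarrow> 'x) \<Rightarrow> (nat \<Rightarrow> 'g set) \<Rightarrow> (real \<Rightarrow> nat \<Rightarrow> 'x \<Rightarrow> real)
      \<Rightarrow> real \<Rightarrow> real \<Rightarrow> 'x set \<Rightarrow> ennreal" where
  "packing_outer \<phi> F w s \<epsilon> H =
     Inf {(\<Sum>i. packing_lim \<phi> F w s \<epsilon> (A i)) | A :: nat \<Rightarrow> 'x set. H \<subseteq> (\<Union>i. A i)}"

definition packing_critical ::
    "('g \<Rightarrow> 'x::metric_space \<Rightarrow> 'x) \<Rightarrow> (nat \<Rightarrow> 'g set) \<Rightarrow> (real \<Rightarrow> nat \<Rightarrow> 'x \<Rightarrow> real)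
      \<Rightarrow> real \<Rightarrow> 'x set \<Rightarrow> ennreal" where
  "packing_critical \<phi> F w \<epsilon> H = Sup {ennreal s | s. s > 0 \<and> packing_outer \<phi> F w s \<epsilon> H = \<infinity>}"

text \<open>All limits \<open>N \<rightarrow> \<infinity>\<close>, \<open>\<epsilon> \<rightarrow> 0\<close> and \<open>\<delta> \<rightarrow> 0\<close> taken with \<open>lim\<close> and \<open>Lim\<close>
  in this theory are limits of monotone \<open>[0,\<infinity>]\<close>-valued functions, hence exist.\<close>

definition BS_packing_dim ::
    "('g \<Rightarrow> 'x::metric_space \<Rightarrow> 'x) \<Rightarrow> (nat \<Rightarrow> 'g set) \<Rightarrow> ('x \<Rightarrow> real) \<Rightarrow> 'x set \<Rightarrow> ennreal" where
  "BS_packing_dim \<phi> F \<Phi> H =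
     Lim (at_right 0) (\<lambda>\<epsilon>. packing_critical \<phi> F (sup_weight \<phi> F \<Phi>) \<epsilon> H)"


section \<open>Dimensions of measures\<close>

text \<open>Extended-valued \<open>-log\<close> on \<open>[0,1]\<close>, with \<open>-log 0 = \<infinity>\<close>; Isabelle's \<open>ln 0\<close> is \<open>0\<close>.\<close>

definition neg_log :: "real \<Rightarrow> ennreal" where
  "neg_log p = (if p = 0 then \<infinity> else ennreal (- ln p))"

definition upper_BK_dim ::
    "('g \<Rightarrow> 'x::metric_space \<Rightarrow> 'x) \<Rightarrow> (nat \<Rightarrow> 'g set) \<Rightarrow> ('x \<Rightarrow> real) \<Rightarrow> 'x measure \<Rightarrow> ennreal" where
  "upper_BK_dim \<phi> F \<Phi> \<mu> =
     (\<integral>\<^sup>+ x. Lim (at_right 0) (\<lambda>\<epsilon>. limsup (\<lambda>n.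
        neg_log (measure \<mu> (bowen_ball \<phi> (F n) x \<epsilon>)) / ennreal (orbit_sum \<phi> \<Phi> (F n) x))) \<partial>\<mu>)"

definition BS_packing_dim_measure ::
    "('g \<Rightarrow> 'x::metric_space \<Rightarrow> 'x) \<Rightarrow> (nat \<Rightarrow> 'g set) \<Rightarrow> ('x \<Rightarrow> real) \<Rightarrow> 'x measure \<Rightarrow> ennreal" where
  "BS_packing_dim_measure \<phi> F \<Phi> \<mu> =
     Lim (at_right 0) (\<lambda>\<epsilon>. Lim (at_right 0) (\<lambda>\<delta>.
       Inf {packing_critical \<phi> F (center_weight \<phi> F \<Phi>) \<epsilon> Z | Z.
         Z \<in> sets borel \<and> measure \<mu> Z \<ge> 1 - \<delta>}))"

definition katok_packing_pre ::
    "('g \<Rightarrow> 'x::metric_space \<Rightarrow> 'x) \<Rightarrow> (nat \<Rightarrow> 'g set) \<Rightarrow> ('x \<Rightarrow> real)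
      \<Rightarrow> real \<Rightarrow> real \<Rightarrow> 'x measure \<Rightarrow> real \<Rightarrow> ennreal" where
  "katok_packing_pre \<phi> F \<Phi> s \<epsilon> \<mu> \<delta> =
     Inf {(\<Sum>i. packing_lim \<phi> F (center_weight \<phi> F \<Phi>) s \<epsilon> (A i)) | A :: nat \<Rightarrow> 'x set.
       (\<Union>i. A i) \<in> sets borel \<and> measure \<mu> (\<Union>i. A i) \<ge> 1 - \<delta>}"

definition katok_packing_critical ::
    "('g \<Rightarrow> 'x::metric_space \<Rightarrow> 'x) \<Rightarrow> (nat \<Rightarrow> 'g set) \<Rightarrow> ('x \<Rightarrow> real)
      \<Rightarrow> real \<Rightarrow> 'x measure \<Rightarrow> real \<Rightarrow> ennreal" where
  "katok_packing_critical \<phi> F \<Phi> \<epsilon> \<mu> \<delta> =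
     Sup {ennreal s | s. s > 0 \<and> katok_packing_pre \<phi> F \<Phi> s \<epsilon> \<mu> \<delta> = \<infinity>}"

definition katok_packing_dim ::
    "('g \<Rightarrow> 'x::metric_space \<Rightarrow> 'x) \<Rightarrow> (nat \<Rightarrow> 'g set) \<Rightarrow> ('x \<Rightarrow> real) \<Rightarrow> 'x measure \<Rightarrow> ennreal" where
  "katok_packing_dim \<phi> F \<Phi> \<mu> =
     Lim (at_right 0) (\<lambda>\<epsilon>. Lim (at_right 0) (\<lambda>\<delta>. katok_packing_critical \<phi> F \<Phi> \<epsilon> \<mu> \<delta>))"

end

theory Submission
  imports Defs
begin

text \<open>
  Two facts carry the proof. Both rest on the growth of \<open>card (F n)\<close>: since \<open>\<Phi>\<close> is bounded below by
  a positive constant, every gain \<open>exp (- \<kappa> * S n x)\<close> with \<open>\<kappa> > 0\<close> is eventually below \<open>1 / n\<^sup>2\<close>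
  (lemma \<open>orbit_sum_decay\<close>), so a loss of a factor \<open>n\<^sup>2\<close> is always paid for by an arbitrarily small
  change of the exponent. By uniform continuity of \<open>\<Phi>\<close> the two weights of a Bowen ball differ by a
  factor tending to \<open>1\<close> as \<open>\<epsilon>\<close> tends to \<open>0\<close>, so that everything can be done with the weight of the
  centre (lemma \<open>BS_packing_dim_eq_center\<close>).

  \<^bold>\<open>Measures bound packing quantities from below.\<close> Suppose that each point \<open>x\<close> of \<open>E\<close> has infinitely
  many \<open>n\<close> with \<open>\<mu> (B n x (3 * \<epsilon>)) \<le> exp (- s' * S n x)\<close>, that \<open>s < s'\<close>, and that the packing
  quantity of \<open>E\<close> with exponent \<open>s\<close> is finite. The points of \<open>E\<close> for which a given \<open>n\<close> works are
  covered by the \<open>3 * \<epsilon>\<close>-balls around a maximal packing, and the total mass of these is at most a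
  constant times \<open>1 / n\<^sup>2\<close>; by Borel-Cantelli \<open>E\<close> is a null set (lemma
  \<open>null_set_if_packing_lim_finite\<close>). Hence the local dimensions of \<open>\<mu>\<close> bound the packing dimension of
  any set carrying \<open>\<mu>\<close>, and also the Katok packing dimension of \<open>\<mu>\<close>. The remaining upper bounds are
  formal: the Katok dimension is at most the packing dimension of \<open>\<mu>\<close>, which is at most that of a
  Borel subset of \<open>H\<close> of full measure.

  \<^bold>\<open>A measure with large local dimension.\<close> Given \<open>s\<close> below the dimension of \<open>H\<close>, lemma
  \<open>frostman_measure\<close> produces a measure on a compact subset of \<open>H\<close> such that every point of that
  subset has infinitely many \<open>n\<close> with \<open>\<mu> (B n x (\<epsilon> / 4)) \<le> exp (- s * S n x)\<close>. Write \<open>H\<close> as the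
  continuous image of a Polish space under \<open>f\<close>. If \<open>H\<close> were a countable union of sets on which, for
  all large \<open>n\<close>, the sums of \<open>exp (- s * S n x)\<close> over \<open>(n, \<epsilon>)\<close>-separated sets are bounded, its
  critical value at radius \<open>\<epsilon>\<close> would be at most \<open>s\<close>, which fails for suitable \<open>\<epsilon>\<close>.
  Discarding the open sets whose images are such countable unions leaves a set \<open>C\<close> that has unbounded
  separated sums near each of its points.

  The measure is the law of \<open>f \<circ> L\<close>, where \<open>L\<close> is a limit of simple random variables on \<open>[0,1]\<close> with
  values in \<open>C\<close>. One step changes the random variable only where it takes a single value \<open>a\<close>: there
  its mass is spread over an \<open>(n, \<epsilon>)\<close>-separated set near \<open>a\<close>, each point \<open>x\<close> receiving at most
  \<open>exp (- s * S n x)\<close>. The sets \<open>F n\<close> are not nested, so at time \<open>n\<close> the mass sitting at other values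
  may be invisible from its earlier separation. Each other value is close in the Bowen metric
  of time \<open>n\<close> to at most one point of the separated set, however, and that point is dropped
  beforehand; as separated sums are unbounded, nothing is lost. This is why the values are treated
  one at a time, each with a time \<open>n\<close> of its own.
\<close>

section \<open>Bowen distances\<close>

lemma bowen_dist_less_iff:
  "finite S \<Longrightarrow> S \<noteq> {} \<Longrightarrow>
    bowen_dist \<phi> S x y < e \<longleftrightarrow> (\<forall>g\<in>S. dist (\<phi> g x) (\<phi> g y) < e)"
  by (simp add: bowen_dist_def)

lemma bowen_dist_le_iff:
  "finite S \<Longrightarrow> S \<noteq> {} \<Longrightarrow>
    bowen_dist \<phi> S x y \<le> e \<longleftrightarrow> (\<forall>g\<in>S. dist (\<phi> g x) (\<phi> g y) \<le> e)"
  by (simp add: bowen_dist_def)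

lemma bowen_dist_commute: "bowen_dist \<phi> S x y = bowen_dist \<phi> S y x"
  by (simp add: bowen_dist_def dist_commute)

lemma bowen_dist_self: "finite S \<Longrightarrow> S \<noteq> {} \<Longrightarrow> bowen_dist \<phi> S x x = 0"
  by (simp add: bowen_dist_def image_constant_conv)

lemma bowen_dist_triangle:
  assumes S: "finite S" "S \<noteq> {}"
  shows "bowen_dist \<phi> S x z \<le> bowen_dist \<phi> S x y + bowen_dist \<phi> S y z"
proof -
  have "dist (\<phi> g x) (\<phi> g z) \<le> bowen_dist \<phi> S x y + bowen_dist \<phi> S y z" if "g \<in> S" for g
  proof -
    have "dist (\<phi> g x) (\<phi> g y) \<le> bowen_dist \<phi> S x y"
      "dist (\<phi> g y) (\<phi> g z) \<le> bowen_dist \<phi> S y z"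
      using S that bowen_dist_le_iff by blast+
    then show ?thesis
      using dist_triangle[of "\<phi> g x" "\<phi> g z" "\<phi> g y"] by linarith
  qed
  then show ?thesis
    using S by (simp add: bowen_dist_le_iff)
qed

lemma open_bowen_ball:
  assumes "finite S" "S \<noteq> {}" "\<And>g. g \<in> S \<Longrightarrow> continuous_on UNIV (\<phi> g)"
  shows "open (bowen_ball \<phi> S x e)"
proof -
  have "bowen_ball \<phi> S x e = (\<Inter>g\<in>S. {y. dist (\<phi> g x) (\<phi> g y) < e})"
    using assms by (auto simp: bowen_ball_def bowen_dist_less_iff)
  moreover have "open {y. dist (\<phi> g x) (\<phi> g y) < e}" if "g \<in> S" for g
    by (intro open_Collect_less continuous_intros assms that)
  ultimately show ?thesis
    using assms by (simp add: open_INT)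
qed

section \<open>Packing quantities and their dependence on the parameters\<close>

lemma ennreal_infsum_leI:
  fixes f :: "'a \<Rightarrow> ennreal"
  assumes "\<And>J. finite J \<Longrightarrow> J \<subseteq> I \<Longrightarrow> sum f J \<le> K"
  shows "infsum f I \<le> K"
  using assms by (auto simp: nonneg_infsum_complete intro!: SUP_least)

lemma sum_le_ennreal_infsum:
  fixes f :: "'a \<Rightarrow> ennreal"
  assumes "finite J" "J \<subseteq> I"
  shows "sum f J \<le> infsum f I"
  using assms by (auto simp: nonneg_infsum_complete intro!: SUP_upper)

text \<open>All limits in the definitions of the dimensions are limits of antitone functions of a positive
  parameter and hence suprema, which are easier to compare.\<close>

lemma tendsto_SUP_at_right_0:
  fixes h :: "real \<Rightarrow> ennreal"
  assumes anti: "\<And>a b. 0 < a \<Longrightarrow> a \<le> b \<Longrightarrow> h b \<le> h a"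
  shows "(h \<longlongrightarrow> (SUP a\<in>{0<..}. h a)) (at_right 0)"
proof (rule order_tendstoI)
  fix l assume "l < (SUP a\<in>{0<..}. h a)"
  then obtain b where b: "0 < b" "l < h b"
    by (auto simp: less_SUP_iff)
  have "\<forall>\<^sub>F a in at_right 0. a < b"
    using b by (auto simp: eventually_at_right_field)
  moreover have "\<forall>\<^sub>F a in at_right (0::real). 0 < a"
    by (rule eventually_at_right_less)
  ultimately show "\<forall>\<^sub>F a in at_right 0. l < h a"
    by eventually_elim (use b anti in \<open>meson less_le_trans less_imp_le\<close>)
next
  fix u assume u: "(SUP a\<in>{0<..}. h a) < u"
  have "\<forall>\<^sub>F a in at_right (0::real). 0 < a"
    by (rule eventually_at_right_less)
  then show "\<forall>\<^sub>F a in at_right 0. h a < u"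
    by eventually_elim (use u in \<open>meson SUP_upper greaterThan_iff le_less_trans\<close>)
qed

lemma Lim_at_right_0_eq_SUP:
  fixes h :: "real \<Rightarrow> ennreal"
  assumes "\<And>a b. 0 < a \<Longrightarrow> a \<le> b \<Longrightarrow> h b \<le> h a"
  shows "Lim (at_right 0) h = (SUP a\<in>{0<..}. h a)"
  by (rule tendsto_Lim[OF _ tendsto_SUP_at_right_0]) (use assms in auto)

lemma ennreal_le_if_le_mult:
  fixes x y :: ennreal
  assumes "\<And>\<kappa>. 1 < \<kappa> \<Longrightarrow> x \<le> ennreal \<kappa> * y"
  shows "x \<le> y"
proof (rule ennreal_le_epsilon)
  fix e :: real assume "y < top_class.top" "0 < e"
  then obtain b where b: "y = ennreal b" "0 \<le> b"
    by (cases y) auto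
  have "x \<le> ennreal (1 + e / (b + 1)) * y"
    using b \<open>0 < e\<close> by (intro assms) simp
  also have "\<dots> = ennreal ((1 + e / (b + 1)) * b)"
    using b \<open>0 < e\<close> by (simp add: ennreal_mult)
  also have "\<dots> \<le> ennreal (b + e)"
  proof (rule ennreal_leI)
    have "e * b \<le> e * (b + 1)"
      using \<open>0 < e\<close> by simp
    then have "e / (b + 1) * b \<le> e"
      using b by (simp add: divide_le_eq)
    then show "(1 + e / (b + 1)) * b \<le> b + e"
      by (simp add: algebra_simps)
  qed
  also have "\<dots> = y + ennreal e"
    using b \<open>0 < e\<close> by simp
  finally show "x \<le> y + ennreal e" .
qed

text \<open>The single comparison behind all monotonicity properties in the radius, the exponent, the set and
  the weight: shrinking the radius keeps balls disjoint, and a smaller exponent or weight makes every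
  term larger.\<close>

lemma packing_pre_le:
  assumes "\<epsilon> \<le> \<epsilon>'" "N \<le> N'" "H' \<subseteq> H"
    and w: "\<And>n x. N' \<le> n \<Longrightarrow> s * w \<epsilon> n x \<le> s' * w' \<epsilon>' n x"
  shows "packing_pre \<phi> F w' s' N' \<epsilon>' H' \<le> packing_pre \<phi> F w s N \<epsilon> H"
  unfolding packing_pre_def[of \<phi> F w']
proof (rule Sup_least, safe)
  fix I :: "nat set" and n x
  assume I: "\<forall>i\<in>I. N' \<le> n i \<and> x i \<in> H'"
    and disj: "disjoint_family_on (\<lambda>i. bowen_cball \<phi> (F (n i)) (x i) \<epsilon>') I"
  have "infsum (\<lambda>i. ennreal (exp (- s' * w' \<epsilon>' (n i) (x i)))) I
      \<le> infsum (\<lambda>i. ennreal (exp (- s * w \<epsilon> (n i) (x i)))) I"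
  proof (rule ennreal_infsum_leI)
    fix J assume J: "finite J" "J \<subseteq> I"
    have "(\<Sum>i\<in>J. ennreal (exp (- s' * w' \<epsilon>' (n i) (x i))))
        \<le> (\<Sum>i\<in>J. ennreal (exp (- s * w \<epsilon> (n i) (x i))))"
      using J I w by (intro sum_mono ennreal_leI) auto
    also have "\<dots> \<le> infsum (\<lambda>i. ennreal (exp (- s * w \<epsilon> (n i) (x i)))) I"
      using J by (rule sum_le_ennreal_infsum)
    finally show "(\<Sum>i\<in>J. ennreal (exp (- s' * w' \<epsilon>' (n i) (x i)))) \<le> \<dots>" .
  qed
  also have "\<dots> \<le> packing_pre \<phi> F w s N \<epsilon> H"
    unfolding packing_pre_def
  proof (rule Sup_upper, rule CollectI, intro exI conjI)
    show "\<forall>i\<in>I. N \<le> n i \<and> x i \<in> H"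
      using I assms by fastforce
    show "disjoint_family_on (\<lambda>i. bowen_cball \<phi> (F (n i)) (x i) \<epsilon>) I"
    proof -
      have "bowen_cball \<phi> (F n) x \<epsilon> \<subseteq> bowen_cball \<phi> (F n) x \<epsilon>'" for n x
        using \<open>\<epsilon> \<le> \<epsilon>'\<close> by (auto simp: bowen_cball_def)
      then show ?thesis
        using disj unfolding disjoint_family_on_def by blast
    qed
  qed (rule refl)
  finally show "infsum (\<lambda>i. ennreal (exp (- s' * w' \<epsilon>' (n i) (x i)))) I
      \<le> packing_pre \<phi> F w s N \<epsilon> H" .
qed

lemma packing_lim_eq_INF:
  "packing_lim \<phi> F w s \<epsilon> H = (INF N. packing_pre \<phi> F w s N \<epsilon> H)"
  unfolding packing_lim_def
  by (intro limI LIMSEQ_INF decseq_def[THEN iffD2] allI impI packing_pre_le) auto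

lemma packing_lim_le:
  assumes "\<epsilon> \<le> \<epsilon>'" "H' \<subseteq> H"
    and "\<forall>\<^sub>F n in sequentially. \<forall>x. s * w \<epsilon> n x \<le> s' * w' \<epsilon>' n x"
  shows "packing_lim \<phi> F w' s' \<epsilon>' H' \<le> packing_lim \<phi> F w s \<epsilon> H"
proof -
  from assms obtain N0 where N0: "\<And>n x. N0 \<le> n \<Longrightarrow> s * w \<epsilon> n x \<le> s' * w' \<epsilon>' n x"
    by (auto simp: eventually_sequentially)
  show ?thesis
    unfolding packing_lim_eq_INF
  proof (rule INF_greatest)
    fix N
    have "(INF N. packing_pre \<phi> F w' s' N \<epsilon>' H') \<le> packing_pre \<phi> F w' s' (max N N0) \<epsilon>' H'"
      by (rule INF_lower) simp
    also have "\<dots> \<le> packing_pre \<phi> F w s N \<epsilon> H"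
      using assms N0 by (intro packing_pre_le) auto
    finally show "(INF N. packing_pre \<phi> F w' s' N \<epsilon>' H') \<le> packing_pre \<phi> F w s N \<epsilon> H" .
  qed
qed

lemma packing_outer_le:
  assumes "\<epsilon> \<le> \<epsilon>'" "H' \<subseteq> H"
    and "\<forall>\<^sub>F n in sequentially. \<forall>x. s * w \<epsilon> n x \<le> s' * w' \<epsilon>' n x"
  shows "packing_outer \<phi> F w' s' \<epsilon>' H' \<le> packing_outer \<phi> F w s \<epsilon> H"
  unfolding packing_outer_def[of _ _ w]
proof (rule Inf_greatest, safe)
  fix A :: "nat \<Rightarrow> _" assume A: "H \<subseteq> (\<Union>i. A i)"
  have "packing_outer \<phi> F w' s' \<epsilon>' H' \<le> (\<Sum>i. packing_lim \<phi> F w' s' \<epsilon>' (A i))"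
    unfolding packing_outer_def using A assms by (intro Inf_lower) blast
  also have "\<dots> \<le> (\<Sum>i. packing_lim \<phi> F w s \<epsilon> (A i))"
    using assms by (intro suminf_le packing_lim_le) auto
  finally show "packing_outer \<phi> F w' s' \<epsilon>' H' \<le> \<dots>" .
qed

text \<open>A factor \<open>\<kappa>\<close> between two weights can be absorbed into the exponent, hence reappears as a factor
  between the critical values.\<close>

lemma packing_critical_le:
  assumes "0 < \<kappa>" "\<epsilon> \<le> \<epsilon>'" "H' \<subseteq> H"
    and ev: "\<forall>\<^sub>F n in sequentially. \<forall>x. w \<epsilon> n x \<le> \<kappa> * w' \<epsilon>' n x"
  shows "packing_critical \<phi> F w' \<epsilon>' H' \<le> ennreal \<kappa> * packing_critical \<phi> F w \<epsilon> H"
  unfolding packing_critical_def[of _ _ w']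
proof (rule Sup_least, safe)
  fix s :: real assume s: "0 < s" and inf: "packing_outer \<phi> F w' s \<epsilon>' H' = \<infinity>"
  have "\<forall>\<^sub>F n in sequentially. \<forall>x. (s / \<kappa>) * w \<epsilon> n x \<le> s * w' \<epsilon>' n x"
    using ev
  proof eventually_elim
    case (elim n)
    show ?case
    proof
      fix x
      have "(s / \<kappa>) * w \<epsilon> n x \<le> (s / \<kappa>) * (\<kappa> * w' \<epsilon>' n x)"
        using elim s \<open>0 < \<kappa>\<close> by (intro mult_left_mono) auto
      then show "(s / \<kappa>) * w \<epsilon> n x \<le> s * w' \<epsilon>' n x"
        using \<open>0 < \<kappa>\<close> by simp
    qed
  qed
  then have "packing_outer \<phi> F w (s / \<kappa>) \<epsilon> H = \<infinity>"
    using packing_outer_le[OF assms(2,3), of "s / \<kappa>" w s w' \<phi> F] inf by (simp add: top_unique)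
  then have "ennreal (s / \<kappa>) \<le> packing_critical \<phi> F w \<epsilon> H"
    unfolding packing_critical_def using s \<open>0 < \<kappa>\<close> by (intro Sup_upper) auto
  then have "ennreal \<kappa> * ennreal (s / \<kappa>) \<le> ennreal \<kappa> * packing_critical \<phi> F w \<epsilon> H"
    by (rule mult_left_mono) simp
  then show "ennreal s \<le> ennreal \<kappa> * packing_critical \<phi> F w \<epsilon> H"
    using \<open>0 < \<kappa>\<close> s by (simp add: ennreal_mult[symmetric])
qed

lemma packing_critical_center_mono:
  assumes "\<epsilon> \<le> \<epsilon>'" "H' \<subseteq> H"
  shows "packing_critical \<phi> F (center_weight \<phi> F \<Phi>) \<epsilon>' H'
    \<le> packing_critical \<phi> F (center_weight \<phi> F \<Phi>) \<epsilon> H"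
  using packing_critical_le[of 1 \<epsilon> \<epsilon>' H' H "center_weight \<phi> F \<Phi>" "center_weight \<phi> F \<Phi>"] assms
  by (simp add: center_weight_def)

lemma finite_packing_le_packing_pre:
  assumes "finite E" "E \<subseteq> H" "N \<le> n"
    and disj: "disjoint_family_on (\<lambda>x. bowen_cball \<phi> (F n) x \<epsilon>) E"
  shows "(\<Sum>x\<in>E. ennreal (exp (- s * w \<epsilon> n x))) \<le> packing_pre \<phi> F w s N \<epsilon> H"
proof -
  obtain h where h: "bij_betw h {0..<card E} E"
    using ex_bij_betw_nat_finite[OF \<open>finite E\<close>] by blast
  have "(\<Sum>x\<in>E. ennreal (exp (- s * w \<epsilon> n x)))
      = (\<Sum>i\<in>{0..<card E}. ennreal (exp (- s * w \<epsilon> n (h i))))"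
    by (rule sum.reindex_bij_betw[OF h, symmetric])
  also have "\<dots> = infsum (\<lambda>i. ennreal (exp (- s * w \<epsilon> n (h i)))) {0..<card E}"
    by simp
  also have "\<dots> \<le> packing_pre \<phi> F w s N \<epsilon> H"
    unfolding packing_pre_def
  proof (rule Sup_upper, rule CollectI, intro exI conjI)
    show "infsum (\<lambda>i. ennreal (exp (- s * w \<epsilon> n (h i)))) {0..<card E}
        = infsum (\<lambda>i. ennreal (exp (- s * w \<epsilon> ((\<lambda>_. n) i) (h i)))) {0..<card E}" by simp
    show "\<forall>i\<in>{0..<card E}. N \<le> n \<and> h i \<in> H"
      using assms h by (auto simp: bij_betw_def)
    show "disjoint_family_on (\<lambda>i. bowen_cball \<phi> (F n) (h i) \<epsilon>) {0..<card E}"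
      using disj h by (simp add: disjoint_family_on_def bij_betw_def inj_on_def) blast
  qed
  finally show ?thesis .
qed

lemma summable_tail_finite_sums:
  fixes g :: "nat \<Rightarrow> real"
  assumes "summable g" "\<And>n. 0 \<le> g n" "0 < e"
  shows "\<exists>N. \<forall>J. finite J \<longrightarrow> J \<subseteq> {N..} \<longrightarrow> sum g J \<le> e"
proof -
  obtain N where N: "\<And>n. N \<le> n \<Longrightarrow> norm (\<Sum>i. g (i + n)) < e"
    using suminf_exist_split[OF \<open>0 < e\<close> \<open>summable g\<close>] by blast
  have "sum g J \<le> e" if J: "finite J" "J \<subseteq> {N..}" for J
  proof -
    have "sum g J = sum (\<lambda>i. g (i + N)) ((\<lambda>j. j - N) ` J)"
      using J by (subst sum.reindex) (auto simp: subset_iff intro!: inj_on_diff_nat sum.cong)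
    also have "\<dots> \<le> (\<Sum>i. g (i + N))"
      using J assms by (intro sum_le_suminf summable_ignore_initial_segment) auto
    also have "\<dots> \<le> e"
      using N[of N] by simp
    finally show ?thesis .
  qed
  then show ?thesis by blast
qed

section \<open>Orbit sums over a sequence of growing finite sets\<close>

locale bowen_packing =
  fixes \<phi> :: "'g \<Rightarrow> 'x::metric_space \<Rightarrow> 'x"
    and F :: "nat \<Rightarrow> 'g set"
    and \<Phi> :: "'x \<Rightarrow> real"
  assumes compact_space: "compact (UNIV :: 'x set)"
    and finite_F: "\<And>n. 1 \<le> n \<Longrightarrow> finite (F n)"
    and nonempty_F: "\<And>n. 1 \<le> n \<Longrightarrow> F n \<noteq> {}"
    and continuous_action: "\<And>n g. 1 \<le> n \<Longrightarrow> g \<in> F n \<Longrightarrow> continuous_on UNIV (\<phi> g)"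
    and growth: "filterlim (\<lambda>n. real (card (F n)) / ln (real n)) at_top sequentially"
    and continuous_potential: "continuous_on UNIV \<Phi>"
    and potential_pos: "\<And>x. 0 < \<Phi> x"
begin

abbreviation "S n x \<equiv> orbit_sum \<phi> \<Phi> (F n) x"
abbreviation "d n \<equiv> bowen_dist \<phi> (F n)"
abbreviation "B n \<equiv> bowen_ball \<phi> (F n)"
abbreviation "P \<equiv> packing_lim \<phi> F (center_weight \<phi> F \<Phi>)"

lemma d_triangle: "1 \<le> n \<Longrightarrow> d n x z \<le> d n x y + d n y z"
  by (simp add: bowen_dist_triangle finite_F nonempty_F)

lemma d_self: "1 \<le> n \<Longrightarrow> d n x x = 0"
  by (simp add: bowen_dist_self finite_F nonempty_F)

lemma open_B: "1 \<le> n \<Longrightarrow> open (B n x e)"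
  by (simp add: open_bowen_ball finite_F nonempty_F continuous_action)

lemma orbit_sum_pos: "1 \<le> n \<Longrightarrow> 0 < S n x"
  unfolding orbit_sum_def by (intro sum_pos finite_F nonempty_F potential_pos)

lemma continuous_on_orbit_sum: "1 \<le> n \<Longrightarrow> continuous_on UNIV (S n)"
  unfolding orbit_sum_def
  by (intro continuous_on_sum continuous_on_compose2[OF continuous_potential]
      continuous_action) auto

lemma potential_bounds: "\<exists>c>0. \<exists>C. \<forall>x. c \<le> \<Phi> x \<and> \<Phi> x \<le> C"
proof -
  obtain a where a: "\<And>x. \<Phi> a \<le> \<Phi> x"
    using continuous_attains_inf[OF compact_space _ continuous_potential] by auto
  obtain b where b: "\<And>x. \<Phi> x \<le> \<Phi> b"
    using continuous_attains_sup[OF compact_space _ continuous_potential] by auto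
  show ?thesis
    using a b potential_pos[of a] by blast
qed

text \<open>The growth condition on \<open>F\<close> enters here and nowhere else: \<open>card (F n)\<close> eventually exceeds any
  multiple of \<open>ln n\<close>.\<close>

lemma orbit_sum_decay:
  assumes "0 < \<kappa>"
  shows "\<forall>\<^sub>F n in sequentially. \<forall>x. exp (- \<kappa> * S n x) \<le> inverse (real n ^ 2)"
proof -
  obtain c where c: "0 < c" "\<And>x. c \<le> \<Phi> x"
    using potential_bounds by blast
  have "\<forall>\<^sub>F n in sequentially. 2 / (\<kappa> * c) \<le> real (card (F n)) / ln (real n)"
    using growth by (auto simp: filterlim_at_top)
  moreover have "\<forall>\<^sub>F n in sequentially. (2::nat) \<le> n"
    by (rule eventually_ge_at_top)
  ultimately show ?thesis
  proof eventually_elim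
    case (elim n)
    have ln: "0 < ln (real n)"
      using elim by simp
    have "2 * ln (real n) \<le> \<kappa> * (real (card (F n)) * c)"
      using elim ln assms c by (simp add: field_simps)
    also have "\<dots> \<le> \<kappa> * S n x" for x
      unfolding orbit_sum_def using assms c by (intro mult_left_mono sum_bounded_below) auto
    finally have "exp (- \<kappa> * S n x) \<le> exp (- (2 * ln (real n)))" for x
      by simp
    also have "exp (- (2 * ln (real n))) = inverse (real n ^ 2)"
      using elim by (simp only: exp_minus exp_double exp_ln)
    finally show ?case by blast
  qed
qed

section \<open>Separated sums control packing quantities\<close>

definition separated :: "nat \<Rightarrow> real \<Rightarrow> 'x set \<Rightarrow> bool" where
  "separated n \<epsilon> E \<longleftrightarrow> (\<forall>x\<in>E. \<forall>y\<in>E. x \<noteq> y \<longrightarrow> \<epsilon> < d n x y)"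

text \<open>Boundedness of the sums over separated sets of one fixed time. In contrast to packings with mixed
  times, the negation yields a single \<open>n\<close> and a finite set, which is what the construction of a
  measure consumes.\<close>

definition bounded_sums :: "real \<Rightarrow> real \<Rightarrow> 'x set \<Rightarrow> bool" where
  "bounded_sums s \<epsilon> A \<longleftrightarrow> (\<exists>M N. \<forall>n\<ge>N. \<forall>E. finite E \<longrightarrow> E \<subseteq> A \<longrightarrow> separated n \<epsilon> E \<longrightarrow>
      (\<Sum>x\<in>E. exp (- s * S n x)) \<le> M)"

lemma mem_cball_self: "1 \<le> n \<Longrightarrow> 0 \<le> \<epsilon> \<Longrightarrow> x \<in> bowen_cball \<phi> (F n) x \<epsilon>"
  by (simp add: bowen_cball_def d_self)

text \<open>A packing is sorted by its times \<open>m\<close>. The centres with time \<open>m\<close> form a separated set, so passing from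
  \<open>s\<close> to \<open>t\<close> bounds their contribution by a constant times \<open>1 / m\<^sup>2\<close>; the packing is then bounded by
  the tail of a convergent series.\<close>

lemma bounded_sums_packing_lim_eq_0:
  assumes "0 \<le> \<epsilon>" "s < t" and bnd: "bounded_sums s \<epsilon> A"
  shows "P t \<epsilon> A = 0"
proof -
  obtain M N0 where "\<forall>n\<ge>N0. \<forall>E. finite E \<longrightarrow> E \<subseteq> A \<longrightarrow> separated n \<epsilon> E \<longrightarrow>
      (\<Sum>x\<in>E. exp (- s * S n x)) \<le> M"
    using bnd unfolding bounded_sums_def by (elim exE)
  then have M: "(\<Sum>x\<in>E. exp (- s * S n x)) \<le> M"
    if "N0 \<le> n" "finite E" "E \<subseteq> A" "separated n \<epsilon> E" for n E
    using that by (elim allE impE) assumption+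
  have "0 \<le> M"
    using M[of N0 "{}"] by (simp add: separated_def)
  obtain N1 where N1: "\<And>n x. N1 \<le> n \<Longrightarrow> exp (- (t - s) * S n x) \<le> inverse (real n ^ 2)"
    using orbit_sum_decay[of "t - s"] \<open>s < t\<close> by (auto simp: eventually_sequentially)
  have "P t \<epsilon> A \<le> 0 + ennreal e" if "0 < e" for e :: real
  proof -
    define e' where "e' = e / (M + 1)"
    have "0 < e'" "M * e' \<le> e"
      using \<open>0 < e\<close> \<open>0 \<le> M\<close> by (auto simp: e'_def field_simps)
    obtain N2 where N2: "\<And>J. finite J \<Longrightarrow> J \<subseteq> {N2..} \<Longrightarrow> (\<Sum>n\<in>J. inverse (real n ^ 2)) \<le> e'"
      using summable_tail_finite_sums[OF inverse_power_summable[of 2] _ \<open>0 < e'\<close>] by auto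
    define N where "N = Max {N0, N1, N2, 1}"
    have N: "N0 \<le> N" "N1 \<le> N" "N2 \<le> N" "1 \<le> N"
      by (auto simp: N_def)
    have "packing_pre \<phi> F (center_weight \<phi> F \<Phi>) t N \<epsilon> A \<le> ennreal e"
      unfolding packing_pre_def
    proof (rule Sup_least, safe, rule ennreal_infsum_leI)
      fix I J :: "nat set" and n :: "nat \<Rightarrow> nat" and x :: "nat \<Rightarrow> 'x"
      assume I: "\<forall>i\<in>I. N \<le> n i \<and> x i \<in> A"
        and disj: "disjoint_family_on (\<lambda>i. bowen_cball \<phi> (F (n i)) (x i) \<epsilon>) I"
        and J: "finite J" "J \<subseteq> I"
      have level: "(\<Sum>i\<in>{i\<in>J. n i = m}. exp (- t * S (n i) (x i))) \<le> inverse (real m ^ 2) * M"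
        if "m \<in> n ` J" for m
      proof -
        let ?J = "{i\<in>J. n i = m}"
        have m: "N \<le> m"
          using that I J by auto
        then have m1: "1 \<le> m"
          using N by simp
        \<comment> \<open>Centres of disjoint balls with equal time cannot lie in each other's ball.\<close>
        have far: "\<epsilon> < d m (x i) (x j)" if "i \<in> ?J" "j \<in> ?J" "i \<noteq> j" for i j
        proof (rule ccontr)
          assume "\<not> \<epsilon> < d m (x i) (x j)"
          then have "x j \<in> bowen_cball \<phi> (F m) (x i) \<epsilon> \<inter> bowen_cball \<phi> (F m) (x j) \<epsilon>"
            using mem_cball_self[OF m1 \<open>0 \<le> \<epsilon>\<close>] by (simp add: bowen_cball_def)
          moreover have "bowen_cball \<phi> (F m) (x i) \<epsilon> \<inter> bowen_cball \<phi> (F m) (x j) \<epsilon> = {}"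
            using disjoint_family_onD[OF disj, of i j] that J by auto
          ultimately show False by simp
        qed
        have inj: "inj_on x ?J"
        proof (rule inj_onI, rule ccontr)
          fix i j assume "i \<in> ?J" "j \<in> ?J" "x i = x j" "i \<noteq> j"
          then show False
            using far[of i j] \<open>0 \<le> \<epsilon>\<close> d_self[OF m1] by simp
        qed
        have "(\<Sum>i\<in>?J. exp (- t * S (n i) (x i))) = (\<Sum>y\<in>x ` ?J. exp (- t * S m y))"
          using inj by (simp add: sum.reindex)
        also have "\<dots> \<le> (\<Sum>y\<in>x ` ?J. inverse (real m ^ 2) * exp (- s * S m y))"
        proof (rule sum_mono)
          fix y
          have "exp (- t * S m y) = exp (- (t - s) * S m y) * exp (- s * S m y)"
            by (simp add: exp_add[symmetric] algebra_simps)
          also have "\<dots> \<le> inverse (real m ^ 2) * exp (- s * S m y)"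
            using N1 m N by (intro mult_right_mono) auto
          finally show "exp (- t * S m y) \<le> inverse (real m ^ 2) * exp (- s * S m y)" .
        qed
        also have "\<dots> = inverse (real m ^ 2) * (\<Sum>y\<in>x ` ?J. exp (- s * S m y))"
          by (simp add: sum_distrib_left)
        also have "\<dots> \<le> inverse (real m ^ 2) * M"
        proof (intro mult_left_mono M)
          show "separated m \<epsilon> (x ` ?J)"
            unfolding separated_def using far by auto
        qed (use m N I J in auto)
        finally show ?thesis .
      qed
      have "(\<Sum>i\<in>J. exp (- t * S (n i) (x i)))
          = (\<Sum>m\<in>n ` J. \<Sum>i\<in>{i\<in>J. n i = m}. exp (- t * S (n i) (x i)))"
        by (rule sum.image_gen[OF \<open>finite J\<close>])
      also have "\<dots> \<le> (\<Sum>m\<in>n ` J. inverse (real m ^ 2) * M)"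
        by (intro sum_mono level)
      also have "\<dots> = M * (\<Sum>m\<in>n ` J. inverse (real m ^ 2))"
        by (simp add: sum_distrib_left mult.commute)
      also have "\<dots> \<le> M * e'"
      proof (intro mult_left_mono N2 \<open>0 \<le> M\<close>)
        show "n ` J \<subseteq> {N2..}"
          using I J N by force
      qed (use J in simp)
      also have "\<dots> \<le> e" by fact
      finally have "(\<Sum>i\<in>J. exp (- t * S (n i) (x i))) \<le> e" .
      then show "(\<Sum>i\<in>J. ennreal (exp (- t * center_weight \<phi> F \<Phi> \<epsilon> (n i) (x i)))) \<le> ennreal e"
        by (simp add: center_weight_def ennreal_leI)
    qed
    moreover have "P t \<epsilon> A \<le> packing_pre \<phi> F (center_weight \<phi> F \<Phi>) t N \<epsilon> A"
      unfolding packing_lim_eq_INF by (rule INF_lower) simp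
    ultimately show ?thesis by simp
  qed
  then have "P t \<epsilon> A \<le> 0"
    by (rule ennreal_le_epsilon)
  then show ?thesis by simp
qed

section \<open>Finite packing quantities force null sets\<close>

text \<open>The points of \<open>E\<close> for which the time \<open>n\<close> works are covered by the \<open>3 * \<epsilon>\<close>-balls around a maximal packing
  by \<open>\<epsilon>\<close>-balls. The packing bound together with \<open>orbit_sum_decay\<close> makes the measures of these covers
  summable, and Borel-Cantelli applies. The set \<open>E\<close> is arbitrary, so its size is measured
  through these open covers.\<close>

lemma null_set_if_packing_lim_finite:
  assumes \<mu>: "prob_space \<mu>" "sets \<mu> = sets borel"
    and "0 < \<epsilon>" "0 < s" "s < s'" and fin: "P s \<epsilon> E \<noteq> \<infinity>"
    and E: "\<And>x. x \<in> E \<Longrightarrow> \<exists>\<^sub>F n in sequentially. measure \<mu> (B n x (3 * \<epsilon>)) \<le> exp (- s' * S n x)"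
  shows "\<exists>Z\<in>null_sets \<mu>. E \<subseteq> Z"
proof -
  interpret prob_space \<mu> by fact
  let ?pre = "\<lambda>N. packing_pre \<phi> F (center_weight \<phi> F \<Phi>) s N \<epsilon> E"
  obtain N0 where "?pre N0 < \<infinity>"
    using fin unfolding packing_lim_eq_INF by (metis INF_greatest infinity_ennreal_def top.not_eq_extremum top_unique)
  then obtain M where M: "?pre N0 = ennreal M" "0 \<le> M"
    by (metis ennreal_cases infinity_ennreal_def less_irrefl)
  obtain N1 where N1: "\<And>n x. N1 \<le> n \<Longrightarrow> exp (- (s' - s) * S n x) \<le> inverse (real n ^ 2)"
    using orbit_sum_decay[of "s' - s"] \<open>s < s'\<close> by (auto simp: eventually_sequentially)
  obtain C where C: "\<And>x. \<Phi> x \<le> C"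
    using potential_bounds by blast
  define N where "N = Max {N0, N1, 1}"
  have N: "N0 \<le> N" "N1 \<le> N" "1 \<le> N"
    by (auto simp: N_def)
  let ?E = "\<lambda>n. {x\<in>E. measure \<mu> (B n x (3 * \<epsilon>)) \<le> exp (- s' * S n x)}"
  have "\<exists>U\<in>sets \<mu>. ?E n \<subseteq> U \<and> measure \<mu> U \<le> M * inverse (real n ^ 2)" if n: "N \<le> n" for n
  proof -
    have n1: "1 \<le> n"
      using n N by simp
    define packing where "packing T \<longleftrightarrow> finite T \<and> T \<subseteq> ?E n \<and>
      disjoint_family_on (\<lambda>x. bowen_cball \<phi> (F n) x \<epsilon>) T" for T
    have weights: "(\<Sum>x\<in>T. exp (- s * S n x)) \<le> M" if "packing T" for T
    proof -
      have "ennreal (\<Sum>x\<in>T. exp (- s * S n x)) \<le> ?pre N0"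
        using finite_packing_le_packing_pre[of T E N0 n \<phi> F \<epsilon> s "center_weight \<phi> F \<Phi>"] that n N
        by (auto simp: packing_def center_weight_def)
      then show ?thesis
        using M by (simp add: ennreal_le_iff)
    qed
    define w where "w = exp (- s * (real (card (F n)) * C))"
    have w: "w \<le> exp (- s * S n x)" for x
      unfolding w_def orbit_sum_def using \<open>0 < s\<close> C by (simp add: sum_bounded_above)
    \<comment> \<open>All weights at time \<open>n\<close> exceed a positive constant, so a bounded sum of weights bounds the size.\<close>
    have card: "card T \<le> nat \<lceil>M / w\<rceil>" if "packing T" for T
    proof -
      have "real (card T) * w \<le> (\<Sum>x\<in>T. exp (- s * S n x))"
        using w by (rule sum_bounded_below)
      then have "real (card T) \<le> M / w"
        using weights[OF that] by (simp add: w_def field_simps)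
      then show ?thesis by linarith
    qed
    have "packing {}"
      by (simp add: packing_def disjoint_family_on_def)
    then have "\<exists>T. packing T \<and> (\<forall>T'. packing T' \<longrightarrow> card T' \<le> card T)"
      by (rule ex_has_greatest_nat[where b = "Suc (nat \<lceil>M / w\<rceil>)"])
        (simp add: card less_Suc_eq_le)
    then obtain T where T: "packing T" and max: "\<And>T'. packing T' \<Longrightarrow> card T' \<le> card T"
      by auto
    define U where "U = (\<Union>x\<in>T. B n x (3 * \<epsilon>))"
    have B: "B n x e \<in> sets \<mu>" for x e
      using open_B[OF n1] \<mu> by simp
    have "U \<in> sets \<mu>"
      using T B by (auto simp: U_def packing_def)
    moreover have "?E n \<subseteq> U"
    proof
      fix y assume y: "y \<in> ?E n"
      show "y \<in> U"
      proof (cases "y \<in> T")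
        case True
        then show ?thesis
          using d_self[OF n1] \<open>0 < \<epsilon>\<close>
          by (auto simp: U_def bowen_ball_def intro!: bexI[of _ y])
      next
        case False
        have "finite T" using T by (simp add: packing_def)
        then have "\<not> packing (insert y T)"
          using max[of "insert y T"] False by auto
        \<comment> \<open>By maximality of \<open>T\<close>, the ball around \<open>y\<close> meets one of the balls of the packing.\<close>
        then have "\<exists>x\<in>T. bowen_cball \<phi> (F n) x \<epsilon> \<inter> bowen_cball \<phi> (F n) y \<epsilon> \<noteq> {}"
          using T y False by (auto simp: packing_def disjoint_family_on_insert)
        then obtain x z where x: "x \<in> T" and z: "d n x z \<le> \<epsilon>" "d n y z \<le> \<epsilon>"
          by (auto simp: bowen_cball_def)
        have "d n x y \<le> d n x z + d n z y"
          by (rule d_triangle[OF n1])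
        then have "d n x y < 3 * \<epsilon>"
          using z \<open>0 < \<epsilon>\<close> bowen_dist_commute[of \<phi> "F n" y z] by simp
        then show ?thesis
          using x by (auto simp: U_def bowen_ball_def)
      qed
    qed
    moreover have "measure \<mu> U \<le> M * inverse (real n ^ 2)"
    proof -
      have "measure \<mu> U \<le> (\<Sum>x\<in>T. measure \<mu> (B n x (3 * \<epsilon>)))"
        unfolding U_def using T B by (intro finite_measure_subadditive_finite) (auto simp: packing_def)
      also have "\<dots> \<le> (\<Sum>x\<in>T. inverse (real n ^ 2) * exp (- s * S n x))"
      proof (rule sum_mono)
        fix x assume "x \<in> T"
        then have "measure \<mu> (B n x (3 * \<epsilon>)) \<le> exp (- s' * S n x)"
          using T by (auto simp: packing_def)
        also have "\<dots> = exp (- (s' - s) * S n x) * exp (- s * S n x)"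
          by (simp add: exp_add[symmetric] algebra_simps)
        also have "\<dots> \<le> inverse (real n ^ 2) * exp (- s * S n x)"
          using N1 n N by (intro mult_right_mono) auto
        finally show "measure \<mu> (B n x (3 * \<epsilon>)) \<le> inverse (real n ^ 2) * exp (- s * S n x)" .
      qed
      also have "\<dots> = inverse (real n ^ 2) * (\<Sum>x\<in>T. exp (- s * S n x))"
        by (simp add: sum_distrib_left)
      also have "\<dots> \<le> inverse (real n ^ 2) * M"
        by (intro mult_left_mono weights T) simp
      finally show ?thesis by (simp add: mult.commute)
    qed
    ultimately show ?thesis by blast
  qed
  then have "\<forall>n. \<exists>U. N \<le> n \<longrightarrow>
      U \<in> sets \<mu> \<and> ?E n \<subseteq> U \<and> measure \<mu> U \<le> M * inverse (real n ^ 2)"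
    by blast
  from choice[OF this] obtain U0 where "\<forall>n\<ge>N. U0 n \<in> sets \<mu> \<and> ?E n \<subseteq> U0 n \<and>
      measure \<mu> (U0 n) \<le> M * inverse (real n ^ 2)"
    by (elim exE)
  then have U0: "U0 n \<in> sets \<mu>" "?E n \<subseteq> U0 n" "measure \<mu> (U0 n) \<le> M * inverse (real n ^ 2)"
    if "N \<le> n" for n
    using that by simp_all
  define U where "U n = (if N \<le> n then U0 n else {})" for n
  have "limsup U \<in> null_sets \<mu>"
  proof (rule borel_cantelli_limsup1)
    show "U n \<in> sets \<mu>" for n
      using U0 by (simp add: U_def)
    show "emeasure \<mu> (U n) < \<infinity>" for n
      by (simp add: emeasure_eq_measure)
    show "summable (\<lambda>n. measure \<mu> (U n))"
    proof (rule summable_comparison_test')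
      show "summable (\<lambda>n. M * inverse (real n ^ 2))"
        by (intro summable_mult inverse_power_summable) simp
      show "norm (measure \<mu> (U n)) \<le> M * inverse (real n ^ 2)" if "N \<le> n" for n
        using U0 that by (simp add: U_def)
    qed
  qed
  moreover have "E \<subseteq> limsup U"
  proof
    fix x assume "x \<in> E"
    have "\<exists>m\<ge>n. x \<in> U m" for n
    proof -
      obtain m where m: "max n N \<le> m" "measure \<mu> (B m x (3 * \<epsilon>)) \<le> exp (- s' * S m x)"
        using E[OF \<open>x \<in> E\<close>] unfolding frequently_sequentially by blast
      then have "x \<in> ?E m" using \<open>x \<in> E\<close> by simp
      then have "x \<in> U m"
        using U0(2)[of m] m by (auto simp: U_def)
      then show ?thesis
        using m by auto
    qed
    then show "x \<in> limsup U"
      by (auto simp: limsup_INF_SUP)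
  qed
  ultimately show ?thesis by blast
qed

end

section \<open>Local dimensions of measures\<close>

text \<open>Translates the extended-valued local dimension quotient into a plain inequality for ball masses.\<close>

lemma neg_log_ratio_ge_iff:
  assumes "0 < S" "0 \<le> p" "0 \<le> s" "p \<le> 1"
  shows "ennreal s \<le> neg_log p / ennreal S \<longleftrightarrow> p \<le> exp (- s * S)"
proof (cases "p = 0")
  case True
  then show ?thesis
    using assms by (simp add: neg_log_def ennreal_top_divide)
next
  case False
  then have p: "0 < p" using assms by simp
  have "ennreal s \<le> neg_log p / ennreal S \<longleftrightarrow> s \<le> - ln p / S"
    using p assms False by (simp add: neg_log_def divide_ennreal ennreal_le_iff divide_nonpos_pos)
  also have "\<dots> \<longleftrightarrow> ln p \<le> - s * S"
    using assms by (auto simp: field_simps)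
  also have "\<dots> \<longleftrightarrow> p \<le> exp (- s * S)"
    using p by (metis exp_le_cancel_iff exp_ln)
  finally show ?thesis .
qed

lemma neg_log_antimono:
  assumes "0 \<le> p" "p \<le> q" "q \<le> 1"
  shows "neg_log q \<le> neg_log p"
  using assms by (auto simp: neg_log_def intro!: ennreal_leI)

lemma prob_measures_on_inner:
  assumes "\<mu> \<in> prob_measures_on H"
  shows "\<exists>Z\<in>sets borel. Z \<subseteq> H \<and> measure \<mu> Z = 1"
proof -
  have \<mu>: "sets \<mu> = sets borel" "emeasure (completion \<mu>) H = 1"
    using assms by (auto simp: prob_measures_on_def borel_prob_measures_def)
  then have H: "H \<in> sets (completion \<mu>)"
    using emeasure_notin_sets by force
  have "emeasure \<mu> (main_part \<mu> H) = 1"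
    using \<mu> H by (simp add: emeasure_completion)
  moreover have "main_part \<mu> H \<in> sets borel"
    using main_part_sets[OF H] \<mu> by simp
  moreover have "main_part \<mu> H \<subseteq> H"
    using main_part_null_part_Un[OF H] by blast
  ultimately show ?thesis
    by (intro bexI[of _ "main_part \<mu> H"]) (auto simp: measure_def)
qed

lemma prob_measures_onI:
  assumes "prob_space \<mu>" "sets \<mu> = sets borel" "Z \<in> sets borel" "Z \<subseteq> H" "measure \<mu> Z = 1"
  shows "\<mu> \<in> prob_measures_on H"
proof -
  interpret prob_space \<mu> by fact
  have space: "space \<mu> = UNIV"
    using sets_eq_imp_space_eq[OF assms(2)] by simp
  have "UNIV - Z \<in> null_sets \<mu>"
    using prob_compl[of Z] assms space by (simp add: null_sets_def emeasure_eq_measure)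
  then have "H - Z \<in> null_sets (completion \<mu>)"
    by (intro null_sets_completionI null_sets_completion_subset[of "H - Z" "UNIV - Z"]) auto
  then have H: "H = Z \<union> (H - Z)" "H - Z \<in> null_sets (completion \<mu>)"
    using assms by auto
  have "emeasure (completion \<mu>) (Z \<union> (H - Z)) = emeasure (completion \<mu>) Z"
    using H assms by (intro emeasure_Un_null_set) auto
  also have "\<dots> = 1"
    using assms by (simp add: emeasure_completion emeasure_eq_measure)
  finally show ?thesis
    using H assms by (simp add: prob_measures_on_def borel_prob_measures_def)
qed

context bowen_packing begin

definition local_upper_dim :: "'x measure \<Rightarrow> real \<Rightarrow> 'x \<Rightarrow> ennreal" where
  "local_upper_dim \<mu> \<epsilon> x = limsup (\<lambda>n. neg_log (measure \<mu> (B n x \<epsilon>)) / ennreal (S n x))"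

lemma local_upper_dim_geI:
  assumes "prob_space \<mu>" "0 \<le> s"
    and freq: "\<exists>\<^sub>F n in sequentially. measure \<mu> (B n x \<epsilon>) \<le> exp (- s * S n x)"
  shows "ennreal s \<le> local_upper_dim \<mu> \<epsilon> x"
proof (rule ccontr)
  interpret prob_space \<mu> by fact
  assume "\<not> ennreal s \<le> local_upper_dim \<mu> \<epsilon> x"
  then have "\<forall>\<^sub>F n in sequentially. neg_log (measure \<mu> (B n x \<epsilon>)) / ennreal (S n x) < ennreal s"
    unfolding local_upper_dim_def by (intro Limsup_lessD) simp
  moreover have "\<forall>\<^sub>F n in sequentially. (1::nat) \<le> n"
    by (rule eventually_ge_at_top)
  ultimately have "\<forall>\<^sub>F n in sequentially. \<not> measure \<mu> (B n x \<epsilon>) \<le> exp (- s * S n x)"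
  proof eventually_elim
    case (elim n)
    then show ?case
      using neg_log_ratio_ge_iff[OF orbit_sum_pos[OF elim(2), of x] measure_nonneg \<open>0 \<le> s\<close> prob_le_1,
          of "B n x \<epsilon>"]
      by (metis not_le)
  qed
  with freq show False
    by (simp add: frequently_def)
qed

lemma local_upper_dim_gtD:
  assumes "prob_space \<mu>" "0 \<le> s" and less: "ennreal s < local_upper_dim \<mu> \<epsilon> x"
  shows "\<exists>\<^sub>F n in sequentially. measure \<mu> (B n x \<epsilon>) \<le> exp (- s * S n x)"
proof (rule ccontr)
  interpret prob_space \<mu> by fact
  assume "\<not> ?thesis"
  then have "\<forall>\<^sub>F n in sequentially. \<not> measure \<mu> (B n x \<epsilon>) \<le> exp (- s * S n x)"
    by (simp add: frequently_def)
  moreover have "\<forall>\<^sub>F n in sequentially. (1::nat) \<le> n"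
    by (rule eventually_ge_at_top)
  ultimately have "\<forall>\<^sub>F n in sequentially. neg_log (measure \<mu> (B n x \<epsilon>)) / ennreal (S n x) \<le> ennreal s"
  proof eventually_elim
    case (elim n)
    then show ?case
      using neg_log_ratio_ge_iff[OF orbit_sum_pos[OF elim(2), of x] measure_nonneg \<open>0 \<le> s\<close> prob_le_1,
          of "B n x \<epsilon>"]
      by (meson nle_le)
  qed
  then have "local_upper_dim \<mu> \<epsilon> x \<le> ennreal s"
    unfolding local_upper_dim_def by (rule Limsup_bounded)
  with less show False by simp
qed

lemma local_upper_dim_antimono:
  assumes "prob_space \<mu>" "sets \<mu> = sets borel" "\<epsilon> \<le> \<epsilon>'"
  shows "local_upper_dim \<mu> \<epsilon>' x \<le> local_upper_dim \<mu> \<epsilon> x"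
  unfolding local_upper_dim_def
proof (rule Limsup_mono)
  interpret prob_space \<mu> by fact
  have "\<forall>\<^sub>F n in sequentially. (1::nat) \<le> n"
    by (rule eventually_ge_at_top)
  then show "\<forall>\<^sub>F n in sequentially. neg_log (measure \<mu> (B n x \<epsilon>')) / ennreal (S n x)
      \<le> neg_log (measure \<mu> (B n x \<epsilon>)) / ennreal (S n x)"
  proof eventually_elim
    case (elim n)
    have "B n x \<epsilon> \<subseteq> B n x \<epsilon>'"
      using assms by (auto simp: bowen_ball_def)
    then have "measure \<mu> (B n x \<epsilon>) \<le> measure \<mu> (B n x \<epsilon>')"
      using open_B[OF elim] assms by (intro finite_measure_mono) auto
    then show ?case
      by (intro divide_right_mono_ennreal neg_log_antimono) auto
  qed
qed

lemma upper_BK_dim_eq: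
  assumes "prob_space \<mu>" "sets \<mu> = sets borel"
  shows "upper_BK_dim \<phi> F \<Phi> \<mu> = (\<integral>\<^sup>+ x. (SUP \<epsilon>\<in>{0<..}. local_upper_dim \<mu> \<epsilon> x) \<partial>\<mu>)"
  unfolding upper_BK_dim_def local_upper_dim_def[symmetric]
  by (intro nn_integral_cong Lim_at_right_0_eq_SUP local_upper_dim_antimono assms)

definition center_packing_dim :: "'x set \<Rightarrow> ennreal" where
  "center_packing_dim H =
    (SUP \<epsilon>\<in>{0<..}. packing_critical \<phi> F (center_weight \<phi> F \<Phi>) \<epsilon> H)"

text \<open>Above the critical value the outer quantity is finite, as the critical value is defined as a
  supremum over the exponents where it is infinite.\<close>

lemma finite_packing_cover:
  assumes "packing_critical \<phi> F (center_weight \<phi> F \<Phi>) \<epsilon> H < ennreal s" "0 < s"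
  shows "\<exists>A :: nat \<Rightarrow> 'x set. H \<subseteq> (\<Union>i. A i) \<and> (\<forall>i. P s \<epsilon> (A i) \<noteq> \<infinity>)"
proof -
  have "packing_outer \<phi> F (center_weight \<phi> F \<Phi>) s \<epsilon> H \<noteq> \<infinity>"
  proof
    assume "packing_outer \<phi> F (center_weight \<phi> F \<Phi>) s \<epsilon> H = \<infinity>"
    then have "ennreal s \<le> packing_critical \<phi> F (center_weight \<phi> F \<Phi>) \<epsilon> H"
      unfolding packing_critical_def using \<open>0 < s\<close> by (intro Sup_upper) auto
    with assms show False by simp
  qed
  then have "packing_outer \<phi> F (center_weight \<phi> F \<Phi>) s \<epsilon> H < \<infinity>"
    by (simp add: less_top)
  then obtain A :: "nat \<Rightarrow> 'x set" where A: "H \<subseteq> (\<Union>i. A i)" "(\<Sum>i. P s \<epsilon> (A i)) < \<infinity>"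
    unfolding packing_outer_def Inf_less_iff by blast
  have "P s \<epsilon> (A i) \<noteq> \<infinity>" for i
    using ennreal_suminf_neq_top A(2) sum_le_suminf[of "\<lambda>i. P s \<epsilon> (A i)" "{i}"]
    by (auto simp: summableI)
  with A show ?thesis by blast
qed

text \<open>If the integral exceeded the dimension, then on a set that is not null some local dimension would
  exceed an exponent above the critical value. But \<open>H\<close> is a countable union of sets of finite packing
  quantity, and on each of these the points of large local dimension form a null set. Working with
  the radii \<open>1 / Suc k\<close> keeps the number of exceptional sets countable.\<close>

lemma upper_BK_dim_le:
  assumes "\<mu> \<in> prob_measures_on H"
  shows "upper_BK_dim \<phi> F \<Phi> \<mu> \<le> center_packing_dim H"
proof (rule ccontr)
  have \<mu>: "prob_space \<mu>" "sets \<mu> = sets borel"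
    using assms by (auto simp: prob_measures_on_def borel_prob_measures_def)
  interpret prob_space \<mu> by fact
  have space: "space \<mu> = UNIV"
    using sets_eq_imp_space_eq[OF \<mu>(2)] by simp
  assume "\<not> ?thesis"
  then obtain a where a: "center_packing_dim H < a" "a < upper_BK_dim \<phi> F \<Phi> \<mu>"
    using dense by (metis not_le)
  obtain b where b: "a < b" "b < upper_BK_dim \<phi> F \<Phi> \<mu>"
    using dense a(2) by blast
  obtain s' where s': "b = ennreal s'" "0 \<le> s'"
    using b by (cases b) auto
  obtain s where s: "a = ennreal s" "0 \<le> s"
    using b by (cases a) auto
  have "0 < s"
    using a(1) s by (metis ennreal_0 less_le not_less_zero)
  have "s < s'"
    using b s s' by (simp add: ennreal_less_iff)
  obtain Z where Z: "Z \<in> sets borel" "Z \<subseteq> H" "measure \<mu> Z = 1"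
    using prob_measures_on_inner[OF assms] by blast
  have in_Z: "AE x in \<mu>. x \<in> Z"
    using Z \<mu> by (simp add: AE_in_set_eq_1)
  have "AE x in \<mu>. local_upper_dim \<mu> (1 / Suc k) x \<le> ennreal s'" for k
  proof -
    \<comment> \<open>The factor 3 is the one lost between a packing and the cover derived from it.\<close>
    define \<epsilon> where "\<epsilon> = 1 / (3 * real (Suc k))"
    have \<epsilon>: "0 < \<epsilon>" "3 * \<epsilon> = 1 / Suc k"
      by (auto simp: \<epsilon>_def field_simps)
    have "packing_critical \<phi> F (center_weight \<phi> F \<Phi>) \<epsilon> H \<le> center_packing_dim H"
      unfolding center_packing_dim_def using \<epsilon> by (intro SUP_upper) simp
    then obtain A :: "nat \<Rightarrow> 'x set" where A: "H \<subseteq> (\<Union>i. A i)" "\<And>i. P s \<epsilon> (A i) \<noteq> \<infinity>"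
      using finite_packing_cover[of \<epsilon> H s] a s \<open>0 < s\<close> by (metis le_less_trans)
    let ?L = "{x. ennreal s' < local_upper_dim \<mu> (3 * \<epsilon>) x}"
    have "\<exists>Y\<in>null_sets \<mu>. A i \<inter> ?L \<subseteq> Y" for i
    proof (rule null_set_if_packing_lim_finite[OF \<mu> \<open>0 < \<epsilon>\<close> \<open>0 < s\<close> \<open>s < s'\<close>])
      have "P s \<epsilon> (A i \<inter> ?L) \<le> P s \<epsilon> (A i)"
        by (intro packing_lim_le) auto
      then show "P s \<epsilon> (A i \<inter> ?L) \<noteq> \<infinity>"
        using A(2)[of i] by (metis infinity_ennreal_def top_unique)
      show "\<exists>\<^sub>F n in sequentially. measure \<mu> (B n x (3 * \<epsilon>)) \<le> exp (- s' * S n x)"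
        if "x \<in> A i \<inter> ?L" for x
        using that by (intro local_upper_dim_gtD \<mu> s') auto
    qed
    then obtain Y where Y: "\<And>i. Y i \<in> null_sets \<mu>" "\<And>i. A i \<inter> ?L \<subseteq> Y i"
      by metis
    have "(\<Union>i. Y i) \<in> null_sets \<mu>"
      using Y by auto
    then have "AE x in \<mu>. x \<notin> (\<Union>i. Y i)"
      by (rule AE_not_in)
    with in_Z show ?thesis
    proof eventually_elim
      case (elim x)
      then obtain i where "x \<in> A i" "x \<notin> Y i"
        using Z(2) A(1) by auto
      then have "x \<notin> ?L"
        using Y(2)[of i] by auto
      then show ?case
        using \<epsilon> by simp
    qed
  qed
  then have "AE x in \<mu>. \<forall>k. local_upper_dim \<mu> (1 / Suc k) x \<le> ennreal s'"
    by (simp add: AE_all_countable)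
  then have "AE x in \<mu>. (SUP \<epsilon>\<in>{0<..}. local_upper_dim \<mu> \<epsilon> x) \<le> ennreal s'"
  proof eventually_elim
    case (elim x)
    show ?case
    proof (rule SUP_least)
      fix \<epsilon> :: real assume "\<epsilon> \<in> {0<..}"
      then obtain k where "1 / Suc k < \<epsilon>"
        using nat_approx_posE[of \<epsilon>] by auto
      then have "local_upper_dim \<mu> \<epsilon> x \<le> local_upper_dim \<mu> (1 / Suc k) x"
        by (intro local_upper_dim_antimono \<mu>) simp
      then show "local_upper_dim \<mu> \<epsilon> x \<le> ennreal s'"
        using elim by (meson order_trans)
    qed
  qed
  then have "upper_BK_dim \<phi> F \<Phi> \<mu> \<le> (\<integral>\<^sup>+ x. ennreal s' \<partial>\<mu>)"
    unfolding upper_BK_dim_eq[OF \<mu>] by (rule nn_integral_mono_AE)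
  also have "\<dots> = ennreal s'"
    by (simp add: emeasure_space_1)
  finally show False
    using b s' by simp
qed

lemma upper_BK_dim_ge:
  assumes \<mu>: "prob_space \<mu>" "sets \<mu> = sets borel" and "0 < \<epsilon>" "0 \<le> s"
    and K: "K \<in> sets borel" "measure \<mu> K = 1"
    and freq: "\<And>x. x \<in> K \<Longrightarrow> \<exists>\<^sub>F n in sequentially. measure \<mu> (B n x \<epsilon>) \<le> exp (- s * S n x)"
  shows "ennreal s \<le> upper_BK_dim \<phi> F \<Phi> \<mu>"
proof -
  interpret prob_space \<mu> by fact
  have "AE x in \<mu>. x \<in> K"
    using K \<mu> by (simp add: AE_in_set_eq_1)
  then have "AE x in \<mu>. ennreal s \<le> (SUP \<epsilon>\<in>{0<..}. local_upper_dim \<mu> \<epsilon> x)"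
  proof eventually_elim
    case (elim x)
    show ?case
      using local_upper_dim_geI[OF \<mu>(1) \<open>0 \<le> s\<close> freq[OF elim]] \<open>0 < \<epsilon>\<close>
      by (intro SUP_upper2[of \<epsilon>]) auto
  qed
  then have "(\<integral>\<^sup>+ x. ennreal s \<partial>\<mu>) \<le> upper_BK_dim \<phi> F \<Phi> \<mu>"
    unfolding upper_BK_dim_eq[OF \<mu>] by (rule nn_integral_mono_AE)
  then show ?thesis
    by (simp add: emeasure_space_1)
qed

section \<open>Packing dimensions of measures\<close>

lemma katok_packing_pre_le:
  assumes "\<epsilon> \<le> \<epsilon>'" "\<delta> \<le> \<delta>'"
  shows "katok_packing_pre \<phi> F \<Phi> s \<epsilon>' \<mu> \<delta>' \<le> katok_packing_pre \<phi> F \<Phi> s \<epsilon> \<mu> \<delta>"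
  unfolding katok_packing_pre_def[of _ _ _ _ \<epsilon>]
proof (rule Inf_greatest, safe)
  fix A :: "nat \<Rightarrow> 'x set"
  assume A: "(\<Union>i. A i) \<in> sets borel" "1 - \<delta> \<le> measure \<mu> (\<Union>i. A i)"
  have "katok_packing_pre \<phi> F \<Phi> s \<epsilon>' \<mu> \<delta>' \<le> (\<Sum>i. P s \<epsilon>' (A i))"
    unfolding katok_packing_pre_def
  proof (rule Inf_lower, rule CollectI, intro exI conjI)
    show "1 - \<delta>' \<le> measure \<mu> (\<Union>i. A i)"
      using A assms by simp
  qed (use A in simp_all)
  also have "\<dots> \<le> (\<Sum>i. P s \<epsilon> (A i))"
    using assms by (intro suminf_le packing_lim_le) (auto simp: center_weight_def)
  finally show "katok_packing_pre \<phi> F \<Phi> s \<epsilon>' \<mu> \<delta>' \<le> (\<Sum>i. P s \<epsilon> (A i))" .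
qed

lemma katok_packing_critical_le:
  assumes "\<epsilon> \<le> \<epsilon>'" "\<delta> \<le> \<delta>'"
  shows "katok_packing_critical \<phi> F \<Phi> \<epsilon>' \<mu> \<delta>' \<le> katok_packing_critical \<phi> F \<Phi> \<epsilon> \<mu> \<delta>"
proof -
  have "katok_packing_pre \<phi> F \<Phi> s \<epsilon> \<mu> \<delta> = \<infinity>" if "katok_packing_pre \<phi> F \<Phi> s \<epsilon>' \<mu> \<delta>' = \<infinity>" for s
    using katok_packing_pre_le[OF assms, of s \<mu>] that by (simp add: top_unique)
  then show ?thesis
    unfolding katok_packing_critical_def by (intro Sup_subset_mono) blast
qed

lemma katok_packing_dim_eq:
  "katok_packing_dim \<phi> F \<Phi> \<mu> =
    (SUP \<epsilon>\<in>{0<..}. SUP \<delta>\<in>{0<..}. katok_packing_critical \<phi> F \<Phi> \<epsilon> \<mu> \<delta>)"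
proof -
  have "Lim (at_right 0) (\<lambda>\<delta>. katok_packing_critical \<phi> F \<Phi> \<epsilon> \<mu> \<delta>)
      = (SUP \<delta>\<in>{0<..}. katok_packing_critical \<phi> F \<Phi> \<epsilon> \<mu> \<delta>)" for \<epsilon>
    by (intro Lim_at_right_0_eq_SUP katok_packing_critical_le) auto
  then show ?thesis
    unfolding katok_packing_dim_def
    by (simp only:) (intro Lim_at_right_0_eq_SUP SUP_mono' katok_packing_critical_le; simp)
qed

lemma BS_packing_dim_measure_eq:
  "BS_packing_dim_measure \<phi> F \<Phi> \<mu> =
    (SUP \<epsilon>\<in>{0<..}. SUP \<delta>\<in>{0<..}.
      Inf {packing_critical \<phi> F (center_weight \<phi> F \<Phi>) \<epsilon> Z | Z.
         Z \<in> sets borel \<and> measure \<mu> Z \<ge> 1 - \<delta>})"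
proof -
  let ?I = "\<lambda>\<epsilon> \<delta>. Inf {packing_critical \<phi> F (center_weight \<phi> F \<Phi>) \<epsilon> Z | Z.
         Z \<in> sets borel \<and> measure \<mu> Z \<ge> 1 - \<delta>}"
  have mono: "?I \<epsilon>' \<delta>' \<le> ?I \<epsilon> \<delta>" if "\<epsilon> \<le> \<epsilon>'" "\<delta> \<le> \<delta>'" for \<epsilon> \<epsilon>' \<delta> \<delta>'
  proof (rule Inf_greatest, safe)
    fix Z assume Z: "Z \<in> sets borel" "1 - \<delta> \<le> measure \<mu> Z"
    have "?I \<epsilon>' \<delta>' \<le> packing_critical \<phi> F (center_weight \<phi> F \<Phi>) \<epsilon>' Z"
    proof (rule Inf_lower, rule CollectI, intro exI conjI)
      show "1 - \<delta>' \<le> measure \<mu> Z"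
        using Z that by simp
    qed (use Z in simp_all)
    also have "\<dots> \<le> packing_critical \<phi> F (center_weight \<phi> F \<Phi>) \<epsilon> Z"
      using that by (intro packing_critical_center_mono) auto
    finally show "?I \<epsilon>' \<delta>' \<le> \<dots>" .
  qed
  have "Lim (at_right 0) (?I \<epsilon>) = (SUP \<delta>\<in>{0<..}. ?I \<epsilon> \<delta>)" for \<epsilon>
    by (intro Lim_at_right_0_eq_SUP mono) auto
  then show ?thesis
    unfolding BS_packing_dim_measure_def
    by (simp only:) (intro Lim_at_right_0_eq_SUP SUP_mono' mono; simp)
qed

lemma BS_packing_dim_measure_le:
  assumes "\<mu> \<in> prob_measures_on H"
  shows "BS_packing_dim_measure \<phi> F \<Phi> \<mu> \<le> center_packing_dim H"
  unfolding BS_packing_dim_measure_eq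
proof (intro SUP_least)
  fix \<epsilon> \<delta> :: real assume "\<epsilon> \<in> {0<..}" "\<delta> \<in> {0<..}"
  obtain Z where Z: "Z \<in> sets borel" "Z \<subseteq> H" "measure \<mu> Z = 1"
    using prob_measures_on_inner[OF assms] by blast
  have "Inf {packing_critical \<phi> F (center_weight \<phi> F \<Phi>) \<epsilon> Z | Z.
         Z \<in> sets borel \<and> measure \<mu> Z \<ge> 1 - \<delta>} \<le> packing_critical \<phi> F (center_weight \<phi> F \<Phi>) \<epsilon> Z"
    using Z \<open>\<delta> \<in> {0<..}\<close> by (intro Inf_lower CollectI exI[of _ Z]) auto
  also have "\<dots> \<le> packing_critical \<phi> F (center_weight \<phi> F \<Phi>) \<epsilon> H"
    using Z by (intro packing_critical_center_mono) auto
  also have "\<dots> \<le> center_packing_dim H"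
    unfolding center_packing_dim_def using \<open>\<epsilon> \<in> {0<..}\<close> by (intro SUP_upper)
  finally show "Inf {packing_critical \<phi> F (center_weight \<phi> F \<Phi>) \<epsilon> Z | Z.
         Z \<in> sets borel \<and> measure \<mu> Z \<ge> 1 - \<delta>} \<le> center_packing_dim H" .
qed

text \<open>Any cover of a Borel set \<open>Z\<close> can be cut down to \<open>Z\<close>, after which its union is Borel.\<close>

lemma katok_packing_dim_le:
  "katok_packing_dim \<phi> F \<Phi> \<mu> \<le> BS_packing_dim_measure \<phi> F \<Phi> \<mu>"
  unfolding katok_packing_dim_eq BS_packing_dim_measure_eq
proof (intro SUP_mono' Inf_greatest, safe)
  fix \<epsilon> \<delta> :: real and Z :: "'x set"
  assume Z: "Z \<in> sets borel" "1 - \<delta> \<le> measure \<mu> Z"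
  have pre: "katok_packing_pre \<phi> F \<Phi> s \<epsilon> \<mu> \<delta> \<le> packing_outer \<phi> F (center_weight \<phi> F \<Phi>) s \<epsilon> Z" for s
    unfolding packing_outer_def
  proof (rule Inf_greatest, safe)
    fix A :: "nat \<Rightarrow> 'x set" assume A: "Z \<subseteq> (\<Union>i. A i)"
    then have "(\<Union>i. A i \<inter> Z) = Z" by blast
    then have "katok_packing_pre \<phi> F \<Phi> s \<epsilon> \<mu> \<delta> \<le> (\<Sum>i. P s \<epsilon> (A i \<inter> Z))"
      unfolding katok_packing_pre_def using Z
      by (intro Inf_lower CollectI exI[of _ "\<lambda>i. A i \<inter> Z"]) simp
    also have "\<dots> \<le> (\<Sum>i. P s \<epsilon> (A i))"
      by (intro suminf_le packing_lim_le) auto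
    finally show "katok_packing_pre \<phi> F \<Phi> s \<epsilon> \<mu> \<delta> \<le> (\<Sum>i. P s \<epsilon> (A i))" .
  qed
  have "packing_outer \<phi> F (center_weight \<phi> F \<Phi>) s \<epsilon> Z = \<infinity>"
    if "katok_packing_pre \<phi> F \<Phi> s \<epsilon> \<mu> \<delta> = \<infinity>" for s
    using pre[of s] that by (simp add: top_unique)
  then show "katok_packing_critical \<phi> F \<Phi> \<epsilon> \<mu> \<delta>
      \<le> packing_critical \<phi> F (center_weight \<phi> F \<Phi>) \<epsilon> Z"
    unfolding katok_packing_critical_def packing_critical_def
    by (intro Sup_subset_mono) blast
qed

text \<open>A family whose union has positive measure has a member that is not null inside \<open>K\<close>; that member
  has infinite packing quantity.\<close>

lemma katok_packing_dim_ge: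
  assumes \<mu>: "prob_space \<mu>" "sets \<mu> = sets borel" and "0 < \<epsilon>" "0 < s" "s < s'"
    and K: "K \<in> sets borel" "measure \<mu> K = 1"
    and freq: "\<And>x. x \<in> K \<Longrightarrow>
      \<exists>\<^sub>F n in sequentially. measure \<mu> (B n x (3 * \<epsilon>)) \<le> exp (- s' * S n x)"
  shows "ennreal s \<le> katok_packing_dim \<phi> F \<Phi> \<mu>"
proof -
  interpret prob_space \<mu> by fact
  have "katok_packing_pre \<phi> F \<Phi> s \<epsilon> \<mu> (1/2) = \<infinity>"
    unfolding katok_packing_pre_def
  proof (rule antisym[OF _ Inf_greatest], simp, safe)
    fix A :: "nat \<Rightarrow> 'x set"
    assume A: "(\<Union>i. A i) \<in> sets borel" "1 - 1/2 \<le> measure \<mu> (\<Union>i. A i)"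
    show "\<infinity> \<le> (\<Sum>i. P s \<epsilon> (A i))"
    proof (rule ccontr)
      assume "\<not> \<infinity> \<le> (\<Sum>i. P s \<epsilon> (A i))"
      then have fin: "P s \<epsilon> (A i) \<noteq> \<infinity>" for i
        using sum_le_suminf[of "\<lambda>i. P s \<epsilon> (A i)" "{i}"] by (auto simp: summableI top_unique)
      have "\<exists>Y\<in>null_sets \<mu>. A i \<inter> K \<subseteq> Y" for i
      proof (rule null_set_if_packing_lim_finite[OF \<mu> \<open>0 < \<epsilon>\<close> \<open>0 < s\<close> \<open>s < s'\<close>])
        have "P s \<epsilon> (A i \<inter> K) \<le> P s \<epsilon> (A i)"
          by (intro packing_lim_le) auto
        then show "P s \<epsilon> (A i \<inter> K) \<noteq> \<infinity>"
          using fin[of i] by (metis infinity_ennreal_def top_unique)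
      qed (use freq in auto)
      then obtain Y where Y: "\<And>i. Y i \<in> null_sets \<mu>" "\<And>i. A i \<inter> K \<subseteq> Y i"
        by metis
      have "(\<Union>i. Y i) \<in> null_sets \<mu>"
        using Y by auto
      then have "AE x in \<mu>. x \<notin> (\<Union>i. Y i)"
        by (rule AE_not_in)
      moreover have "AE x in \<mu>. x \<in> K"
        using K \<mu> by (simp add: AE_in_set_eq_1)
      ultimately have "AE x in \<mu>. x \<notin> (\<Union>i. A i)"
        by eventually_elim (use Y in blast)
      then have "measure \<mu> (\<Union>i. A i) = 0"
        using A \<mu> prob_eq_0 by metis
      with A show False by simp
    qed
  qed
  then have "ennreal s \<le> katok_packing_critical \<phi> F \<Phi> \<epsilon> \<mu> (1/2)"
    unfolding katok_packing_critical_def using \<open>0 < s\<close> by (intro Sup_upper) auto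
  also have "\<dots> \<le> katok_packing_dim \<phi> F \<Phi> \<mu>"
    unfolding katok_packing_dim_eq using \<open>0 < \<epsilon>\<close>
    by (intro SUP_upper2[of \<epsilon>] SUP_upper) auto
  finally show ?thesis .
qed

end

section \<open>Distributing Lebesgue measure according to prescribed weights\<close>

definition unit_lebesgue :: "real measure" where
  "unit_lebesgue = uniform_measure lborel {0..1}"

lemma space_unit_lebesgue [simp]: "space unit_lebesgue = UNIV"
  by (simp add: unit_lebesgue_def)

lemma sets_unit_lebesgue [simp, measurable_cong]: "sets unit_lebesgue = sets borel"
  by (simp add: unit_lebesgue_def)

lemma prob_space_unit_lebesgue: "prob_space unit_lebesgue"
  unfolding unit_lebesgue_def by (rule prob_space_uniform_measure) auto

lemma measure_unit_lebesgue:
  "A \<in> sets borel \<Longrightarrow> measure unit_lebesgue A = measure lborel ({0..1} \<inter> A)"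
  unfolding unit_lebesgue_def by (subst measure_uniform_measure) auto

interpretation unit_lebesgue: prob_space unit_lebesgue
  by (rule prob_space_unit_lebesgue)

text \<open>The distribution function of \<open>A\<close> is continuous, so the intermediate value theorem applies.\<close>

lemma unit_lebesgue_subset_of_measure:
  assumes A: "A \<in> sets borel" and c: "0 \<le> c" "c \<le> measure unit_lebesgue A"
  shows "\<exists>B\<in>sets borel. B \<subseteq> A \<and> measure unit_lebesgue B = c"
proof -
  let ?g = "\<lambda>t. measure unit_lebesgue (A \<inter> {..t})"
  have lip: "\<bar>?g t - ?g u\<bar> \<le> \<bar>t - u\<bar>" if "t \<le> u" for t u
  proof -
    have "?g u = measure unit_lebesgue ((A \<inter> {..t}) \<union> (A \<inter> {t<..u}))"
      using that by (intro arg_cong[where f = "measure unit_lebesgue"]) auto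
    also have "\<dots> = ?g t + measure unit_lebesgue (A \<inter> {t<..u})"
      using A by (intro unit_lebesgue.finite_measure_Union) auto
    finally have "?g u - ?g t = measure unit_lebesgue (A \<inter> {t<..u})"
      by simp
    moreover have "measure unit_lebesgue (A \<inter> {t<..u}) \<le> measure lborel {t..u}"
      unfolding measure_unit_lebesgue[OF sets.Int[OF A greaterThanAtMost_borel]]
      by (rule measure_mono_fmeasurable) (use A that in \<open>auto simp: fmeasurable_def\<close>)
    moreover have "0 \<le> measure unit_lebesgue (A \<inter> {t<..u})"
      by simp
    moreover have "measure lborel {t..u} = u - t"
      using that by simp
    ultimately show ?thesis
      using that by linarith
  qed
  have "1-lipschitz_on {0..1} ?g"
  proof (rule lipschitz_onI)
    show "dist (?g t) (?g u) \<le> 1 * dist t u" for t u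
      using lip[of t u] lip[of u t] by (cases "t \<le> u") (auto simp: dist_real_def abs_minus_commute)
  qed simp
  then have cont: "continuous_on {0..1} ?g"
    by (rule lipschitz_on_continuous_on)
  have "?g 0 \<le> measure lborel {0::real}"
    unfolding measure_unit_lebesgue[OF sets.Int[OF A atMost_borel]]
    by (rule measure_mono_fmeasurable) (use A in \<open>auto simp: fmeasurable_def\<close>)
  then have "?g 0 \<le> c"
    using c by simp
  moreover have "c \<le> ?g 1"
  proof -
    have "{0..1} \<inter> (A \<inter> {..1}) = {0..1::real} \<inter> A" by auto
    then show ?thesis
      using A c by (simp add: measure_unit_lebesgue)
  qed
  ultimately obtain t where "?g t = c"
    using IVT'[OF _ _ _ cont] by auto
  then show ?thesis
    using A by (intro bexI[of _ "A \<inter> {..t}"]) auto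
qed

text \<open>The mass of \<open>A\<close> is poured into the points of \<open>E\<close> one after the other, each point \<open>y\<close> taking at most its
  capacity \<open>w y\<close>; the total capacity suffices.\<close>

lemma unit_lebesgue_weighted_partition:
  fixes w :: "'a \<Rightarrow> real"
  assumes "finite E" "E \<noteq> {}" "A \<in> sets borel" "\<And>y. y \<in> E \<Longrightarrow> 0 \<le> w y"
    and "measure unit_lebesgue A \<le> sum w E"
  shows "\<exists>h. \<forall>\<omega>\<in>A. h \<omega> \<in> E \<and> A \<inter> h -` {h \<omega>} \<in> sets borel \<and>
    measure unit_lebesgue (A \<inter> h -` {h \<omega>}) \<le> w (h \<omega>)"
proof -
  have "\<exists>h. (\<forall>\<omega>\<in>A. h \<omega> \<in> E) \<and>
      (\<forall>y\<in>E. A \<inter> h -` {y} \<in> sets borel \<and> measure unit_lebesgue (A \<inter> h -` {y}) \<le> w y)"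
    using assms
  proof (induction E arbitrary: A rule: finite_ne_induct)
    case (singleton y)
    show ?case
      by (rule exI[of _ "\<lambda>_. y"]) (use singleton in auto)
  next
    case (insert y E)
    define c where "c = min (measure unit_lebesgue A) (w y)"
    have "0 \<le> c" "c \<le> measure unit_lebesgue A"
      using insert.prems by (auto simp: c_def)
    then obtain B where B: "B \<in> sets borel" "B \<subseteq> A" "measure unit_lebesgue B = c"
      using unit_lebesgue_subset_of_measure insert.prems(1) by blast
    have "measure unit_lebesgue (A - B) = measure unit_lebesgue A - c"
      using B insert.prems by (simp add: unit_lebesgue.finite_measure_Diff)
    moreover have "0 \<le> sum w E"
      using insert.prems by (intro sum_nonneg) auto
    ultimately have "measure unit_lebesgue (A - B) \<le> sum w E"
      using insert.prems insert.hyps by (auto simp: c_def min_def)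
    moreover have "A - B \<in> sets borel"
      using insert.prems B by blast
    ultimately obtain h where "(\<forall>\<omega>\<in>A - B. h \<omega> \<in> E) \<and> (\<forall>z\<in>E. (A - B) \<inter> h -` {z} \<in> sets borel \<and>
        measure unit_lebesgue ((A - B) \<inter> h -` {z}) \<le> w z)"
      using insert.IH[of "A - B"] insert.prems(2) by auto
    then have h: "\<And>\<omega>. \<omega> \<in> A - B \<Longrightarrow> h \<omega> \<in> E"
      "\<And>z. z \<in> E \<Longrightarrow> (A - B) \<inter> h -` {z} \<in> sets borel"
      "\<And>z. z \<in> E \<Longrightarrow> measure unit_lebesgue ((A - B) \<inter> h -` {z}) \<le> w z"
      by simp_all
    let ?h = "\<lambda>\<omega>. if \<omega> \<in> B then y else h \<omega>"
    have y: "A \<inter> ?h -` {y} = B"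
    proof (intro equalityI subsetI)
      fix \<omega> assume "\<omega> \<in> A \<inter> ?h -` {y}"
      then show "\<omega> \<in> B"
        using h(1)[of \<omega>] insert.hyps by (cases "\<omega> \<in> B") auto
    qed (use B in auto)
    have z: "A \<inter> ?h -` {z} = (A - B) \<inter> h -` {z}" if "z \<in> E" for z
      using that insert.hyps by auto
    show ?case
    proof (rule exI[of _ ?h], intro conjI ballI)
      show "?h \<omega> \<in> insert y E" if "\<omega> \<in> A" for \<omega>
        using h that by auto
      show "A \<inter> ?h -` {v} \<in> sets borel" if "v \<in> insert y E" for v
        using that y z h B by (cases "v = y") auto
      show "measure unit_lebesgue (A \<inter> ?h -` {v}) \<le> w v" if "v \<in> insert y E" for v
        using that y z h B by (cases "v = y") (auto simp: c_def)
    qed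
  qed
  then show ?thesis by blast
qed

lemma simple_function_Collect:
  assumes "simple_function (borel :: real measure) T"
  shows "{\<omega>. Q (T \<omega>)} \<in> sets borel"
proof -
  have "{\<omega>. Q (T \<omega>)} = (\<Union>v\<in>range T \<inter> {v. Q v}. T -` {v})"
    by auto
  moreover have "\<dots> \<in> sets borel"
    using assms by (intro sets.finite_UN) (auto simp: simple_function_def)
  ultimately show ?thesis by simp
qed

context bowen_packing begin

section \<open>The part of a set that is large near each of its points\<close>

definition sigma_bounded :: "real \<Rightarrow> real \<Rightarrow> 'x set \<Rightarrow> bool" where
  "sigma_bounded s \<epsilon> A \<longleftrightarrow>
    (\<exists>\<C>. countable \<C> \<and> A \<subseteq> \<Union>\<C> \<and> (\<forall>B\<in>\<C>. bounded_sums s \<epsilon> B))"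

lemma bounded_sums_empty: "bounded_sums s \<epsilon> {}"
  by (auto simp: bounded_sums_def)

lemma sigma_bounded_Union:
  assumes "countable \<U>" and U: "\<And>A. A \<in> \<U> \<Longrightarrow> sigma_bounded s \<epsilon> A"
  shows "sigma_bounded s \<epsilon> (\<Union>\<U>)"
proof -
  obtain \<C> where \<C>: "\<And>A. A \<in> \<U> \<Longrightarrow> countable (\<C> A)" "\<And>A. A \<in> \<U> \<Longrightarrow> A \<subseteq> \<Union>(\<C> A)"
      "\<And>A B. A \<in> \<U> \<Longrightarrow> B \<in> \<C> A \<Longrightarrow> bounded_sums s \<epsilon> B"
    using U unfolding sigma_bounded_def by metis
  show ?thesis
    unfolding sigma_bounded_def
  proof (intro exI conjI)
    show "countable (\<Union>(\<C> ` \<U>))"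
      using \<C>(1) assms by (intro countable_UN)
    show "\<Union>\<U> \<subseteq> \<Union>(\<Union>(\<C> ` \<U>))"
      using \<C>(2) by blast
    show "\<forall>B\<in>\<Union>(\<C> ` \<U>). bounded_sums s \<epsilon> B"
      using \<C>(3) by blast
  qed
qed

text \<open>The contrapositive shows that a set of dimension above \<open>s\<close> is not a countable union of sets with
  bounded sums.\<close>

lemma sigma_bounded_packing_outer_eq_0:
  assumes "0 \<le> \<epsilon>" "s < t" "sigma_bounded s \<epsilon> H"
  shows "packing_outer \<phi> F (center_weight \<phi> F \<Phi>) t \<epsilon> H = 0"
proof -
  obtain \<C> where \<C>: "countable \<C>" "H \<subseteq> \<Union>\<C>" "\<And>B. B \<in> \<C> \<Longrightarrow> bounded_sums s \<epsilon> B"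
    using assms(3) unfolding sigma_bounded_def by blast
  define A where "A = from_nat_into (insert {} \<C>)"
  have A: "range A = insert {} \<C>"
    unfolding A_def using \<C>(1) by (intro range_from_nat_into) auto
  have "P t \<epsilon> (A i) = 0" for i
  proof (rule bounded_sums_packing_lim_eq_0[OF assms(1,2)])
    have "A i \<in> insert {} \<C>"
      using A by blast
    then show "bounded_sums s \<epsilon> (A i)"
      using \<C>(3) bounded_sums_empty by auto
  qed
  then have "(\<Sum>i. P t \<epsilon> (A i)) = 0"
    by simp
  moreover have "H \<subseteq> (\<Union>i. A i)"
    using \<C>(2) A by auto
  ultimately have "packing_outer \<phi> F (center_weight \<phi> F \<Phi>) t \<epsilon> H \<le> 0"
    unfolding packing_outer_def by (intro Inf_lower) (metis (mono_tags, lifting) mem_Collect_eq)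
  then show ?thesis by simp
qed

text \<open>\<open>C\<close> is the complement of the largest open set whose image is \<open>sigma_bounded\<close>; that such a largest set
  exists is the Lindelof property of the domain. This is done in the domain of \<open>f\<close> rather than in its
  range because limits of points will be formed there.\<close>

lemma unbounded_kernel:
  fixes f :: "'b::second_countable_topology \<Rightarrow> 'x"
  assumes "\<not> sigma_bounded s \<epsilon> (range f)"
  shows "\<exists>C. C \<noteq> {} \<and> (\<forall>V. open V \<longrightarrow> V \<inter> C \<noteq> {} \<longrightarrow> \<not> bounded_sums s \<epsilon> (f ` (V \<inter> C)))"
proof -
  let ?\<U> = "{V. open V \<and> sigma_bounded s \<epsilon> (f ` V)}"
  obtain \<U> where \<U>: "\<U> \<subseteq> ?\<U>" "countable \<U>" "\<Union>\<U> = \<Union>?\<U>"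
    using Lindelof[of ?\<U>] by auto
  have "sigma_bounded s \<epsilon> (\<Union>((`) f ` \<U>))"
    using \<U> by (intro sigma_bounded_Union) auto
  then have small: "sigma_bounded s \<epsilon> (f ` \<Union>?\<U>)"
    by (simp only: \<U>(3)[symmetric] image_Union)
  define C where "C = - \<Union>?\<U>"
  have "\<not> bounded_sums s \<epsilon> (f ` (V \<inter> C))" if V: "open V" "V \<inter> C \<noteq> {}" for V
  proof
    assume "bounded_sums s \<epsilon> (f ` (V \<inter> C))"
    then have "sigma_bounded s \<epsilon> (f ` (V \<inter> C))"
      unfolding sigma_bounded_def by (intro exI[of _ "{f ` (V \<inter> C)}"]) auto
    then have "sigma_bounded s \<epsilon> (\<Union>{f ` (V \<inter> C), f ` \<Union>?\<U>})"
      using small by (intro sigma_bounded_Union) auto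
    moreover have "f ` V \<subseteq> \<Union>{f ` (V \<inter> C), f ` \<Union>?\<U>}"
      unfolding C_def by auto
    ultimately have "sigma_bounded s \<epsilon> (f ` V)"
      unfolding sigma_bounded_def by (meson order_trans)
    with V show False
      by (auto simp: C_def)
  qed
  moreover have "C \<noteq> {}"
  proof
    assume "C = {}"
    then have "\<Union>?\<U> = UNIV"
      unfolding C_def by blast
    with small assms show False by simp
  qed
  ultimately show ?thesis by blast
qed

section \<open>Refining simple random variables\<close>

text \<open>Here \<open>T\<close> is a random variable known up to an error \<open>r\<close>. The estimate demanded at \<open>\<omega>\<close> is stated for
  all variables within that error at once, so that it survives every later refinement and the
  passage to the limit.\<close>

definition resolved :: "('b::metric_space \<Rightarrow> 'x) \<Rightarrow> real \<Rightarrow> real \<Rightarrow> nat \<Rightarrow> (real \<Rightarrow> 'b) \<Rightarrow> real \<Rightarrow> real \<Rightarrow> bool" where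
  "resolved f s \<epsilon> N T r \<omega> \<longleftrightarrow> (\<exists>n\<ge>N. 1 \<le> n \<and> (\<forall>z\<in>cball (T \<omega>) r.
      measure unit_lebesgue {\<omega>'. \<exists>z'\<in>cball (T \<omega>') r. d n (f z) (f z') < \<epsilon> / 4}
        \<le> exp (- s * S n (f z))))"

text \<open>The first two conditions force the errors of successive refinements to tend to \<open>0\<close>; the last makes
  the balls of radius \<open>r\<close> around the values nested.\<close>

definition refines :: "(real \<Rightarrow> 'b::metric_space) \<Rightarrow> real \<Rightarrow> (real \<Rightarrow> 'b) \<Rightarrow> real \<Rightarrow> bool" where
  "refines T' r' T r \<longleftrightarrow> 0 < r' \<and> r' \<le> r / 2 \<and> (\<forall>\<omega>. dist (T' \<omega>) (T \<omega>) + r' \<le> r)"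

lemma refines_cball:
  assumes "refines T' r' T r"
  shows "cball (T' \<omega>) r' \<subseteq> cball (T \<omega>) r"
proof
  fix z assume "z \<in> cball (T' \<omega>) r'"
  moreover have "dist (T' \<omega>) (T \<omega>) + r' \<le> r"
    using assms by (simp add: refines_def)
  ultimately show "z \<in> cball (T \<omega>) r"
    using dist_triangle[of "T \<omega>" z "T' \<omega>"] by (simp add: dist_commute)
qed

lemma refines_trans:
  assumes "refines T2 r2 T1 r1" "refines T1 r1 T r"
  shows "refines T2 r2 T r"
  unfolding refines_def
proof (intro conjI allI)
  fix \<omega>
  have "dist (T2 \<omega>) (T1 \<omega>) + r2 \<le> r1" "dist (T1 \<omega>) (T \<omega>) + r1 \<le> r"
    using assms by (auto simp: refines_def)
  then show "dist (T2 \<omega>) (T \<omega>) + r2 \<le> r"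
    using dist_triangle[of "T2 \<omega>" "T \<omega>" "T1 \<omega>"] by linarith
qed (use assms in \<open>auto simp: refines_def\<close>)

lemma resolved_refines:
  assumes "resolved f s \<epsilon> N T r \<omega>" "refines T' r' T r" "simple_function borel T"
  shows "resolved f s \<epsilon> N T' r' \<omega>"
proof -
  obtain n where n: "N \<le> n" "1 \<le> n" and bound: "\<forall>z\<in>cball (T \<omega>) r.
      measure unit_lebesgue {\<omega>'. \<exists>z'\<in>cball (T \<omega>') r. d n (f z) (f z') < \<epsilon> / 4}
        \<le> exp (- s * S n (f z))"
    using assms(1) unfolding resolved_def by (elim exE conjE)
  have sub: "cball (T' \<omega>) r' \<subseteq> cball (T \<omega>) r" for \<omega>
    by (rule refines_cball[OF assms(2)])
  have "measure unit_lebesgue {\<omega>'. \<exists>z'\<in>cball (T' \<omega>') r'. d n (f z) (f z') < \<epsilon> / 4}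
      \<le> exp (- s * S n (f z))" if "z \<in> cball (T' \<omega>) r'" for z
  proof -
    have "measure unit_lebesgue {\<omega>'. \<exists>z'\<in>cball (T' \<omega>') r'. d n (f z) (f z') < \<epsilon> / 4}
        \<le> measure unit_lebesgue {\<omega>'. \<exists>z'\<in>cball (T \<omega>') r. d n (f z) (f z') < \<epsilon> / 4}"
    proof (rule unit_lebesgue.finite_measure_mono)
      show "{\<omega>'. \<exists>z'\<in>cball (T \<omega>') r. d n (f z) (f z') < \<epsilon> / 4} \<in> sets unit_lebesgue"
        using simple_function_Collect[OF assms(3), of "\<lambda>v. \<exists>z'\<in>cball v r. d n (f z) (f z') < \<epsilon> / 4"]
        by simp
    qed (use sub in blast)
    also have "\<dots> \<le> exp (- s * S n (f z))"
      using that sub by (intro bound[rule_format]) blast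
    finally show ?thesis .
  qed
  then show ?thesis
    unfolding resolved_def using n by (intro exI[of _ n] conjI ballI)
qed

text \<open>The value \<open>a\<close> is replaced by the points of a separated set near \<open>a\<close> with large weighted sum, the mass of
  \<open>{T = a}\<close> being distributed according to the weights. For a ball around one of the new values to
  carry only the mass of that value, the new values must be far, at time \<open>n\<close>, from each other and from
  the old ones. The former is separation; the latter costs at most one point for each old value, because
  two points within \<open>\<epsilon> / 2\<close> of the same point are within \<open>\<epsilon>\<close> of each other. A starting sum above
  \<open>card (range T) + 1\<close> therefore leaves a sum of at least \<open>1\<close>, enough to hold any mass.\<close>

lemma refine_value:
  fixes f :: "'b::metric_space \<Rightarrow> 'x"
  assumes f: "continuous_on UNIV f" and "0 < \<epsilon>" "0 < s'" "s' < s"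
    and C: "\<And>V. open V \<Longrightarrow> V \<inter> C \<noteq> {} \<Longrightarrow> \<not> bounded_sums s \<epsilon> (f ` (V \<inter> C))"
    and T: "simple_function borel T" "range T \<subseteq> C" and "0 < r" and a: "a \<in> range T"
  shows "\<exists>T' r'. simple_function borel T' \<and> range T' \<subseteq> C \<and> refines T' r' T r \<and>
    (\<forall>\<omega>. T \<omega> \<noteq> a \<longrightarrow> T' \<omega> = T \<omega>) \<and> (\<forall>\<omega>. T \<omega> = a \<longrightarrow> resolved f s' \<epsilon> N T' r' \<omega>)"
proof -
  have fin_T: "finite (range T)"
    using T by (simp add: simple_function_def)
  let ?V = "ball a (r / 4)"
  have "a \<in> ?V \<inter> C"
    using a T \<open>0 < r\<close> by auto
  then have "\<not> bounded_sums s \<epsilon> (f ` (?V \<inter> C))"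
    by (intro C open_ball) blast
  then have "\<not> (\<forall>n\<ge>max N 1. \<forall>E. finite E \<longrightarrow> E \<subseteq> f ` (?V \<inter> C) \<longrightarrow> separated n \<epsilon> E \<longrightarrow>
      (\<Sum>x\<in>E. exp (- s * S n x)) \<le> real (card (range T)) + 1)"
    unfolding bounded_sums_def by (elim contrapos_nn) (intro exI, assumption)
  then obtain n E where n: "N \<le> n" "1 \<le> n"
    and E: "finite E" "E \<subseteq> f ` (?V \<inter> C)" and sep: "separated n \<epsilon> E"
    and large: "real (card (range T)) + 1 < (\<Sum>x\<in>E. exp (- s * S n x))"
    by (auto simp: not_le simp del: mult_minus_left)
  let ?w = "\<lambda>x. exp (- s * S n x)"
  define Bad where "Bad = {x\<in>E. \<exists>b\<in>range T. d n x (f b) < \<epsilon> / 2}"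
  have "\<forall>x\<in>Bad. \<exists>b. b \<in> range T \<and> d n x (f b) < \<epsilon> / 2"
    unfolding Bad_def by blast
  from bchoice[OF this] obtain near
    where near: "\<forall>x\<in>Bad. near x \<in> range T \<and> d n x (f (near x)) < \<epsilon> / 2" by blast
  have "inj_on near Bad"
  proof (rule inj_onI, rule ccontr)
    fix x y assume xy: "x \<in> Bad" "y \<in> Bad" "near x = near y" "x \<noteq> y"
    have "d n x y \<le> d n x (f (near x)) + d n (f (near x)) y"
      by (rule d_triangle[OF n(2)])
    also have "\<dots> < \<epsilon>"
      using bspec[OF near xy(1)] bspec[OF near xy(2)] xy(3)
        bowen_dist_commute[of \<phi> "F n" "f (near x)" y] by simp
    finally have "d n x y < \<epsilon>" .
    moreover have "\<epsilon> < d n x y"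
      using sep xy unfolding separated_def Bad_def by blast
    ultimately show False by simp
  qed
  then have card_Bad: "card Bad \<le> card (range T)"
    using near fin_T by (intro card_inj_on_le[of near]) auto
  define E' where "E' = E - Bad"
  have "finite E'"
    using E by (simp add: E'_def)
  have "1 \<le> sum ?w E'"
  proof -
    have "sum ?w Bad \<le> (\<Sum>x\<in>Bad. 1)"
      using orbit_sum_pos[OF n(2)] assms by (intro sum_mono) (simp add: less_imp_le)
    then have "sum ?w Bad \<le> real (card (range T))"
      using card_Bad by simp
    moreover have "sum ?w E = sum ?w E' + sum ?w Bad"
      unfolding E'_def using E by (intro sum.subset_diff) (auto simp: Bad_def)
    ultimately show ?thesis
      using large by linarith
  qed
  then have "E' \<noteq> {}" by force
  have "\<forall>x\<in>E'. \<exists>z. z \<in> ?V \<inter> C \<and> f z = x"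
    using E unfolding E'_def by blast
  from bchoice[OF this] obtain g where g: "\<forall>x\<in>E'. g x \<in> ?V \<inter> C \<and> f (g x) = x"
    by blast
  let ?A = "T -` {a}"
  have A: "?A \<in> sets borel"
    using simple_function_Collect[OF T(1), of "\<lambda>v. v = a"] by (simp add: vimage_def)
  have "measure unit_lebesgue ?A \<le> sum ?w E'"
    using \<open>1 \<le> sum ?w E'\<close> unit_lebesgue.prob_le_1[of ?A] by linarith
  then obtain h where "\<forall>\<omega>\<in>?A. h \<omega> \<in> E' \<and> ?A \<inter> h -` {h \<omega>} \<in> sets borel \<and>
      measure unit_lebesgue (?A \<inter> h -` {h \<omega>}) \<le> ?w (h \<omega>)"
    using unit_lebesgue_weighted_partition[OF \<open>finite E'\<close> \<open>E' \<noteq> {}\<close> A, of ?w] by auto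
  then have h: "h \<omega> \<in> E'" "?A \<inter> h -` {h \<omega>} \<in> sets borel"
      "measure unit_lebesgue (?A \<inter> h -` {h \<omega>}) \<le> ?w (h \<omega>)" if "T \<omega> = a" for \<omega>
    using that by simp_all
  define T' where "T' \<omega> = (if T \<omega> = a then g (h \<omega>) else T \<omega>)" for \<omega>
  have fin_T': "finite (range T')"
    by (rule finite_subset[of _ "g ` E' \<union> range T"])
      (use h(1) fin_T \<open>finite E'\<close> in \<open>auto simp: T'_def\<close>)
  have simple: "simple_function borel T'"
    unfolding simple_function_def
  proof (intro conjI ballI)
    fix v
    have "T' -` {v} = (\<Union>x\<in>h ` ?A \<inter> {x. g x = v}. ?A \<inter> h -` {x}) \<union> {\<omega>. T \<omega> \<noteq> a \<and> T \<omega> = v}"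
      by (auto simp: T'_def split: if_splits)
    moreover have "(\<Union>x\<in>h ` ?A \<inter> {x. g x = v}. ?A \<inter> h -` {x}) \<in> sets borel"
    proof (rule sets.finite_UN)
      show "finite (h ` ?A \<inter> {x. g x = v})"
        by (rule finite_subset[OF _ \<open>finite E'\<close>]) (use h(1) in auto)
    qed (use h(2) in auto)
    ultimately show "T' -` {v} \<inter> space borel \<in> sets borel"
      using simple_function_Collect[OF T(1), of "\<lambda>u. u \<noteq> a \<and> u = v"] by auto
  qed (use fin_T' in simp)
  \<comment> \<open>The passage from \<open>s\<close> to \<open>s'\<close> leaves room for the variation of the orbit sum near \<open>v\<close>.\<close>
  have "\<exists>\<rho>>0. \<forall>z\<in>cball v \<rho>. d n (f v) (f z) < \<epsilon> / 16 \<and> s' * S n (f z) < s * S n (f v)" for v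
  proof -
    let ?O = "f -` B n (f v) (\<epsilon> / 16) \<inter> {z. s' * S n (f z) < s * S n (f v)}"
    have "open ?O"
      using n(2) by (intro open_Int open_vimage open_B f open_Collect_less continuous_intros
          continuous_on_compose2[OF continuous_on_orbit_sum f]) auto
    moreover have "v \<in> ?O"
      using d_self[OF n(2)] \<open>0 < \<epsilon>\<close> \<open>s' < s\<close> orbit_sum_pos[OF n(2)] by (simp add: bowen_ball_def)
    ultimately obtain \<rho> where "0 < \<rho>" "cball v \<rho> \<subseteq> ?O"
      by (meson open_contains_cball)
    then show ?thesis
      by (auto simp: bowen_ball_def intro!: exI[of _ \<rho>])
  qed
  then obtain \<rho> where \<rho>: "\<And>v. 0 < \<rho> v" "\<And>v z. z \<in> cball v (\<rho> v) \<Longrightarrow>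
      d n (f v) (f z) < \<epsilon> / 16 \<and> s' * S n (f z) < s * S n (f v)"
    by metis
  define r' where "r' = min (Min (\<rho> ` range T')) (r / 4)"
  have "0 < r'" "r' \<le> r / 4"
    using \<rho>(1) fin_T' \<open>0 < r\<close> by (auto simp: r'_def)
  have close: "d n (f (T' \<omega>)) (f z) < \<epsilon> / 16 \<and> s' * S n (f z) < s * S n (f (T' \<omega>))"
    if "z \<in> cball (T' \<omega>) r'" for z \<omega>
  proof (rule \<rho>(2))
    have "r' \<le> \<rho> (T' \<omega>)"
      using fin_T' by (auto simp: r'_def min.coboundedI1)
    then show "z \<in> cball (T' \<omega>) (\<rho> (T' \<omega>))"
      using that by auto
  qed
  have "refines T' r' T r"
    unfolding refines_def
  proof (intro conjI allI)
    fix \<omega>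
    have "dist (T' \<omega>) (T \<omega>) \<le> r / 4"
      using g h(1)[of \<omega>] \<open>0 < r\<close> by (auto simp: T'_def dist_commute less_imp_le)
    then show "dist (T' \<omega>) (T \<omega>) + r' \<le> r"
      using \<open>r' \<le> r / 4\<close> \<open>0 < r\<close> by linarith
  qed (use \<open>0 < r'\<close> \<open>r' \<le> r / 4\<close> \<open>0 < r\<close> in linarith)+
  moreover have "range T' \<subseteq> C"
    using g h(1) T(2) by (auto simp: T'_def)
  moreover have "resolved f s' \<epsilon> N T' r' \<omega>" if \<omega>: "T \<omega> = a" for \<omega>
    unfolding resolved_def
  proof (intro exI conjI ballI)
    fix z assume z: "z \<in> cball (T' \<omega>) r'"
    have x: "h \<omega> \<in> E'" "f (T' \<omega>) = h \<omega>"
      using \<omega> h(1) g by (auto simp: T'_def)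
    have "{\<omega>'. \<exists>z'\<in>cball (T' \<omega>') r'. d n (f z) (f z') < \<epsilon> / 4} \<subseteq> ?A \<inter> h -` {h \<omega>}"
    proof safe
      fix \<omega>' z' assume z': "z' \<in> cball (T' \<omega>') r'" and less: "d n (f z) (f z') < \<epsilon> / 4"
      have "d n (h \<omega>) (f (T' \<omega>')) \<le> d n (h \<omega>) (f z) + (d n (f z) (f z') + d n (f z') (f (T' \<omega>')))"
        using d_triangle[OF n(2)] by (meson add_left_mono order_trans)
      also have "\<dots> < \<epsilon> / 16 + (\<epsilon> / 4 + \<epsilon> / 16)"
        using close[OF z] close[OF z'] less x bowen_dist_commute[of \<phi> "F n" "f z'"]
        by (intro add_strict_mono) auto
      finally have near: "d n (h \<omega>) (f (T' \<omega>')) < \<epsilon> / 2"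
        using \<open>0 < \<epsilon>\<close> by simp
      have "T \<omega>' = a"
      proof (rule ccontr)
        assume "T \<omega>' \<noteq> a"
        then have "h \<omega> \<in> Bad"
          using near x(1) by (auto simp: Bad_def E'_def T'_def)
        with x(1) show False
          by (simp add: E'_def)
      qed
      then have x': "h \<omega>' \<in> E'" "f (T' \<omega>') = h \<omega>'"
        using h(1) g by (auto simp: T'_def)
      have "h \<omega>' = h \<omega>"
      proof (rule ccontr)
        assume "h \<omega>' \<noteq> h \<omega>"
        then have "\<epsilon> < d n (h \<omega>) (h \<omega>')"
          using sep x x' by (auto simp: separated_def E'_def)
        with near x' \<open>0 < \<epsilon>\<close> show False by simp
      qed
      with \<open>T \<omega>' = a\<close> show "\<omega>' \<in> T -` {a}" "\<omega>' \<in> h -` {h \<omega>}" by auto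
    qed
    then have "measure unit_lebesgue {\<omega>'. \<exists>z'\<in>cball (T' \<omega>') r'. d n (f z) (f z') < \<epsilon> / 4}
        \<le> measure unit_lebesgue (?A \<inter> h -` {h \<omega>})"
      using h(2)[OF \<omega>] by (intro unit_lebesgue.finite_measure_mono) auto
    also have "\<dots> \<le> exp (- s * S n (h \<omega>))"
      by (rule h(3)[OF \<omega>])
    also have "\<dots> \<le> exp (- s' * S n (f z))"
      using close[OF z] x by simp
    finally show "measure unit_lebesgue {\<omega>'. \<exists>z'\<in>cball (T' \<omega>') r'. d n (f z) (f z') < \<epsilon> / 4}
        \<le> exp (- s' * S n (f z))" .
  qed (use n in auto)
  moreover have "T' \<omega> = T \<omega>" if "T \<omega> \<noteq> a" for \<omega>
    using that by (simp add: T'_def)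
  ultimately show ?thesis
    using simple by blast
qed

text \<open>The values are treated one after the other; what has been achieved for earlier values is kept by
  \<open>resolved_refines\<close>.\<close>

lemma refine_all_values:
  fixes f :: "'b::metric_space \<Rightarrow> 'x"
  assumes f: "continuous_on UNIV f" and "0 < \<epsilon>" "0 < s'" "s' < s"
    and C: "\<And>V. open V \<Longrightarrow> V \<inter> C \<noteq> {} \<Longrightarrow> \<not> bounded_sums s \<epsilon> (f ` (V \<inter> C))"
    and T: "simple_function borel T" "range T \<subseteq> C" and "0 < r"
  shows "\<exists>T' r'. simple_function borel T' \<and> range T' \<subseteq> C \<and> refines T' r' T r \<and>
    (\<forall>\<omega>. resolved f s' \<epsilon> N T' r' \<omega>)"
proof -
  have "finite (range T)"
    using T by (simp add: simple_function_def)
  have "\<exists>T' r'. simple_function borel T' \<and> range T' \<subseteq> C \<and> refines T' r' T r \<and>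
      (\<forall>\<omega>. T \<omega> \<notin> D \<longrightarrow> T' \<omega> = T \<omega>) \<and> (\<forall>\<omega>. T \<omega> \<in> D \<longrightarrow> resolved f s' \<epsilon> N T' r' \<omega>)"
    if "finite D" "D \<subseteq> range T" for D
    using that
  proof (induction D)
    case empty
    have "refines T (r / 2) T r"
      using \<open>0 < r\<close> by (simp add: refines_def)
    then show ?case
      using T by blast
  next
    case (insert a D)
    then obtain T1 r1 where T1: "simple_function borel T1" "range T1 \<subseteq> C" "refines T1 r1 T r"
      and same1: "\<And>\<omega>. T \<omega> \<notin> D \<Longrightarrow> T1 \<omega> = T \<omega>"
      and res1: "\<And>\<omega>. T \<omega> \<in> D \<Longrightarrow> resolved f s' \<epsilon> N T1 r1 \<omega>"
      by auto
    obtain \<omega>0 where "T \<omega>0 = a"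
      using insert.prems by auto
    then have "T1 \<omega>0 = a"
      using insert.hyps same1[of \<omega>0] by simp
    then have "a \<in> range T1" by blast
    moreover have "0 < r1"
      using T1 by (simp add: refines_def)
    ultimately obtain T2 r2
      where T2: "simple_function borel T2" "range T2 \<subseteq> C" "refines T2 r2 T1 r1"
      and same2: "\<And>\<omega>. T1 \<omega> \<noteq> a \<Longrightarrow> T2 \<omega> = T1 \<omega>"
      and res2: "\<And>\<omega>. T1 \<omega> = a \<Longrightarrow> resolved f s' \<epsilon> N T2 r2 \<omega>"
      using refine_value[OF f \<open>0 < \<epsilon>\<close> \<open>0 < s'\<close> \<open>s' < s\<close> C T1(1,2), of r1 a N] by auto
    have "refines T2 r2 T r"
      using T2(3) T1(3) by (rule refines_trans)
    moreover have "T2 \<omega> = T \<omega>" if "T \<omega> \<notin> insert a D" for \<omega>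
      using that same1[of \<omega>] same2[of \<omega>] by simp
    moreover have "resolved f s' \<epsilon> N T2 r2 \<omega>" if \<omega>: "T \<omega> \<in> insert a D" for \<omega>
    proof (cases "T \<omega> \<in> D")
      case True
      then show ?thesis
        using resolved_refines[OF res1 T2(3) T1(1)] by blast
    next
      case False
      then show ?thesis
        using \<omega> same1[of \<omega>] res2[of \<omega>] by simp
    qed
    ultimately show ?case
      using T2(1,2) by blast
  qed
  from this[OF \<open>finite (range T)\<close> subset_refl] show ?thesis
    by blast
qed

section \<open>A measure of large local dimension\<close>

text \<open>The random variables \<open>T N\<close> converge uniformly to \<open>L\<close>. The set \<open>K\<close> of all points compatible with every \<open>T N\<close>
  up to its error is closed and totally bounded, hence compact, and contains all values of \<open>L\<close>. Each
  point of \<open>K\<close> is, for every \<open>N\<close>, within the error of some value of \<open>T (Suc N)\<close>, so it inherits the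
  estimate of \<open>resolved\<close> for a time at least \<open>N\<close>.\<close>

lemma frostman_measure:
  fixes f :: "'b::polish_space \<Rightarrow> 'x"
  assumes f: "continuous_on UNIV f" and "0 < \<epsilon>" "0 < s'" "s' < s"
    and unbounded: "\<not> sigma_bounded s \<epsilon> (range f)"
  shows "\<exists>\<mu> K. prob_space \<mu> \<and> sets \<mu> = sets borel \<and> K \<in> sets borel \<and> K \<subseteq> range f \<and>
    measure \<mu> K = 1 \<and>
    (\<forall>x\<in>K. \<exists>\<^sub>F n in sequentially. measure \<mu> (B n x (\<epsilon> / 4)) \<le> exp (- s' * S n x))"
proof -
  obtain C where "C \<noteq> {}"
    and C: "\<And>V. open V \<Longrightarrow> V \<inter> C \<noteq> {} \<Longrightarrow> \<not> bounded_sums s \<epsilon> (f ` (V \<inter> C))"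
    using unbounded_kernel[OF unbounded] by auto
  then obtain c where "c \<in> C" by blast
  define good where "good p \<longleftrightarrow> simple_function borel (fst p) \<and> range (fst p) \<subseteq> C \<and> 0 < snd p"
    for p :: "(real \<Rightarrow> 'b) \<times> real"
  define step where "step N p q \<longleftrightarrow> refines (fst q) (snd q) (fst p) (snd p) \<and>
      (\<forall>\<omega>. resolved f s' \<epsilon> N (fst q) (snd q) \<omega>)" for N and p q :: "(real \<Rightarrow> 'b) \<times> real"
  have "\<exists>p. \<forall>N. good (p N) \<and> step N (p N) (p (Suc N))"
  proof (rule dependent_nat_choice)
    show "\<exists>p. good p"
      using \<open>c \<in> C\<close> by (intro exI[of _ "(\<lambda>_. c, 1)"]) (auto simp: good_def)
    show "\<exists>q. good q \<and> step N p q" if "good p" for N p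
    proof -
      have "simple_function borel (fst p)" "range (fst p) \<subseteq> C" "0 < snd p"
        using that by (simp_all add: good_def)
      from refine_all_values[OF f \<open>0 < \<epsilon>\<close> \<open>0 < s'\<close> \<open>s' < s\<close> C this, of N]
      obtain T' r' where "simple_function borel T'" "range T' \<subseteq> C" "refines T' r' (fst p) (snd p)"
        "\<forall>\<omega>. resolved f s' \<epsilon> N T' r' \<omega>"
        by blast
      then show ?thesis
        by (intro exI[of _ "(T', r')"]) (auto simp: good_def step_def refines_def)
    qed
  qed
  then obtain p where p: "\<And>N. good (p N)" "\<And>N. step N (p N) (p (Suc N))" by blast
  define T where "T N = fst (p N)" for N
  define r where "r N = snd (p N)" for N
  have T: "simple_function borel (T N)" and r_pos: "0 < r N" for N
    using p(1)[of N] by (auto simp: good_def T_def r_def)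
  have refines: "refines (T (Suc N)) (r (Suc N)) (T N) (r N)"
    and resolved: "resolved f s' \<epsilon> N (T (Suc N)) (r (Suc N)) \<omega>" for N \<omega>
    using p(2)[of N] by (auto simp: step_def T_def r_def)
  have r_le: "r N \<le> r 0 * (1 / 2) ^ N" for N
  proof (induction N)
    case (Suc N)
    then show ?case
      using refines[of N] by (simp add: refines_def)
  qed simp
  have r_lim: "r \<longlonglongrightarrow> 0"
  proof (rule tendsto_sandwich)
    show "\<forall>\<^sub>F N in sequentially. 0 \<le> r N"
      using r_pos by (simp add: less_imp_le)
    show "\<forall>\<^sub>F N in sequentially. r N \<le> r 0 * (1 / 2) ^ N"
      using r_le by simp
    show "(\<lambda>N. r 0 * (1 / 2) ^ N) \<longlonglongrightarrow> 0"
      by (intro tendsto_mult_right_zero LIMSEQ_power_zero) simp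
  qed simp
  have dist_r: "dist (T (N + k) \<omega>) (T N \<omega>) + r (N + k) \<le> r N" for N k \<omega>
  proof (induction k)
    case (Suc k)
    have "dist (T (Suc (N + k)) \<omega>) (T (N + k) \<omega>) + r (Suc (N + k)) \<le> r (N + k)"
      using refines[of "N + k"] by (simp add: refines_def)
    with Suc show ?case
      using dist_triangle[of "T (Suc (N + k)) \<omega>" "T N \<omega>" "T (N + k) \<omega>"] by simp
  qed simp
  have dist_T: "dist (T m \<omega>) (T N \<omega>) \<le> r N" if "N \<le> m" for m N \<omega>
    using dist_r[of N "m - N" \<omega>] r_pos[of m] that by simp
  have "\<exists>l. (\<lambda>N. T N \<omega>) \<longlonglongrightarrow> l" for \<omega>
  proof -
    have "Cauchy (\<lambda>N. T N \<omega>)"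
    proof (rule metric_CauchyI)
      fix e :: real assume "0 < e"
      then obtain N where N: "r N < e / 2"
        using order_tendstoD(2)[OF r_lim, of "e / 2"] by (auto simp: eventually_sequentially)
      have "dist (T m \<omega>) (T n \<omega>) < e" if "N \<le> m" "N \<le> n" for m n
        using dist_T[OF that(1), of \<omega>] dist_T[OF that(2), of \<omega>] N
          dist_triangle2[of "T m \<omega>" "T n \<omega>" "T N \<omega>"] by linarith
      then show "\<exists>M. \<forall>m\<ge>M. \<forall>n\<ge>M. dist (T m \<omega>) (T n \<omega>) < e" by blast
    qed
    then show ?thesis
      by (simp add: Cauchy_convergent_iff convergent_def)
  qed
  then obtain L where L: "\<And>\<omega>. (\<lambda>N. T N \<omega>) \<longlonglongrightarrow> L \<omega>" by metis
  have L_in: "L \<omega> \<in> cball (T N \<omega>) (r N)" for N \<omega>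
  proof -
    have "\<forall>\<^sub>F m in sequentially. T m \<omega> \<in> cball (T N \<omega>) (r N)"
      using eventually_ge_at_top[of N] by eventually_elim (simp add: dist_T dist_commute)
    then show ?thesis
      by (rule Lim_in_closed_set[OF closed_cball _ _ L]) simp
  qed
  have "L \<in> borel_measurable borel"
    by (rule borel_measurable_LIMSEQ_metric[OF borel_measurable_simple_function[OF T] L])
  then have fL: "f \<circ> L \<in> unit_lebesgue \<rightarrow>\<^sub>M borel"
    using f by (intro measurable_comp[OF _ borel_measurable_continuous_onI])
      (simp_all cong: measurable_cong_sets)
  define \<mu> where "\<mu> = distr unit_lebesgue borel (f \<circ> L)"
  have \<mu>: "prob_space \<mu>" "sets \<mu> = sets borel"
    using unit_lebesgue.prob_space_distr[OF fL] by (auto simp: \<mu>_def)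
  define K where "K = (\<Inter>N. \<Union>v\<in>range (T N). cball v (r N))"
  have fin: "finite (range (T N))" for N
    using T by (simp add: simple_function_def)
  have "compact K"
    unfolding compact_eq_totally_bounded
  proof (intro conjI allI impI)
    show "complete K"
      unfolding complete_eq_closed K_def using fin by (intro closed_INT ballI closed_UN) auto
    fix e :: real assume "0 < e"
    then obtain N where N: "r N < e"
      using order_tendstoD(2)[OF r_lim, of e] by (auto simp: eventually_sequentially)
    have "K \<subseteq> (\<Union>v\<in>range (T N). ball v e)"
    proof
      fix z assume "z \<in> K"
      then obtain v where "v \<in> range (T N)" "z \<in> cball v (r N)"
        unfolding K_def by blast
      then show "z \<in> (\<Union>v\<in>range (T N). ball v e)"
        using N by (intro UN_I[of v]) auto
    qed
    then show "\<exists>k. finite k \<and> K \<subseteq> (\<Union>v\<in>k. ball v e)"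
      using fin by blast
  qed
  then have "compact (f ` K)"
    using f by (intro compact_continuous_image continuous_on_subset[OF f]) auto
  then have K: "f ` K \<in> sets borel"
    by (intro borel_closed compact_imp_closed)
  have "L \<omega> \<in> K" for \<omega>
    using L_in unfolding K_def by blast
  then have "(f \<circ> L) -` (f ` K) \<inter> space unit_lebesgue = UNIV"
    by auto
  then have "measure \<mu> (f ` K) = 1"
    unfolding \<mu>_def using measure_distr[OF fL K] unit_lebesgue.prob_space by simp
  moreover have "\<exists>\<^sub>F n in sequentially. measure \<mu> (B n x (\<epsilon> / 4)) \<le> exp (- s' * S n x)"
    if "x \<in> f ` K" for x
    unfolding frequently_sequentially
  proof
    fix N
    obtain z where z: "z \<in> K" "x = f z"
      using \<open>x \<in> f ` K\<close> by blast
    then obtain \<omega> where \<omega>: "z \<in> cball (T (Suc N) \<omega>) (r (Suc N))"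
      unfolding K_def by blast
    let ?Q = "\<lambda>n. {\<omega>'. \<exists>z'\<in>cball (T (Suc N) \<omega>') (r (Suc N)). d n (f z) (f z') < \<epsilon> / 4}"
    obtain n where n: "N \<le> n" "1 \<le> n"
      and bound: "\<forall>z\<in>cball (T (Suc N) \<omega>) (r (Suc N)). measure unit_lebesgue
        {\<omega>'. \<exists>z'\<in>cball (T (Suc N) \<omega>') (r (Suc N)). d n (f z) (f z') < \<epsilon> / 4}
          \<le> exp (- s' * S n (f z))"
      using resolved[of N \<omega>] unfolding resolved_def by (elim exE conjE)
    have "measure \<mu> (B n x (\<epsilon> / 4)) = measure unit_lebesgue ((f \<circ> L) -` B n x (\<epsilon> / 4))"
      unfolding \<mu>_def using measure_distr[OF fL borel_open[OF open_B[OF n(2)]]] by simp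
    also have "\<dots> \<le> measure unit_lebesgue (?Q n)"
    proof (rule unit_lebesgue.finite_measure_mono)
      show "(f \<circ> L) -` B n x (\<epsilon> / 4) \<subseteq> ?Q n"
        using L_in[of _ "Suc N"] z by (force simp: bowen_ball_def simp del: mem_cball)
      show "?Q n \<in> sets unit_lebesgue"
        using simple_function_Collect[OF T[of "Suc N"],
            of "\<lambda>v. \<exists>z'\<in>cball v (r (Suc N)). d n (f z) (f z') < \<epsilon> / 4"] by simp
    qed
    also have "\<dots> \<le> exp (- s' * S n x)"
      using bound \<omega> z by blast
    finally show "\<exists>n\<ge>N. measure \<mu> (B n x (\<epsilon> / 4)) \<le> exp (- s' * S n x)"
      using n by blast
  qed
  ultimately show ?thesis
    using \<mu> K by blast
qed

section \<open>Comparison of the two weights\<close>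

lemma bdd_above_orbit_sum: "1 \<le> n \<Longrightarrow> bdd_above (S n ` A)"
  by (rule bdd_above_mono[OF bounded_imp_bdd_above[OF compact_imp_bounded[OF
          compact_continuous_image[OF continuous_on_orbit_sum compact_space]]]]) auto

lemma sup_weight_mono:
  assumes "1 \<le> n" "0 \<le> \<epsilon>" "\<epsilon> \<le> \<epsilon>'"
  shows "sup_weight \<phi> F \<Phi> \<epsilon> n x \<le> sup_weight \<phi> F \<Phi> \<epsilon>' n x"
  unfolding sup_weight_def
proof (rule cSUP_subset_mono)
  show "bowen_cball \<phi> (F n) x \<epsilon> \<noteq> {}"
    using mem_cball_self[OF assms(1,2)] by blast
qed (use assms bdd_above_orbit_sum in \<open>auto simp: bowen_cball_def\<close>)

lemma center_weight_le_sup_weight: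
  assumes "1 \<le> n" "0 \<le> \<epsilon>"
  shows "center_weight \<phi> F \<Phi> \<epsilon> n x \<le> sup_weight \<phi> F \<Phi> \<epsilon> n x"
  unfolding sup_weight_def center_weight_def
  using assms by (intro cSUP_upper mem_cball_self bdd_above_orbit_sum)

lemma sup_weight_le_center_weight:
  assumes "1 < \<kappa>"
  shows "\<exists>\<epsilon>0>0. \<forall>\<epsilon> n x. 0 \<le> \<epsilon> \<longrightarrow> \<epsilon> \<le> \<epsilon>0 \<longrightarrow> 1 \<le> n \<longrightarrow>
    sup_weight \<phi> F \<Phi> \<epsilon> n x \<le> \<kappa> * center_weight \<phi> F \<Phi> \<epsilon> n x"
proof -
  obtain c where c: "0 < c" "\<And>x. c \<le> \<Phi> x"
    using potential_bounds by blast
  have "uniformly_continuous_on UNIV \<Phi>"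
    by (rule compact_uniformly_continuous[OF continuous_potential compact_space])
  moreover have "0 < (\<kappa> - 1) * c"
    using assms c by simp
  ultimately obtain \<eta> where \<eta>: "0 < \<eta>" "\<And>x y. dist y x < \<eta> \<Longrightarrow> dist (\<Phi> y) (\<Phi> x) < (\<kappa> - 1) * c"
    unfolding uniformly_continuous_on_def by (metis UNIV_I)
  have pot: "\<Phi> y \<le> \<kappa> * \<Phi> x" if "dist x y \<le> \<eta> / 2" for x y
  proof -
    have "\<Phi> y \<le> \<Phi> x + (\<kappa> - 1) * c"
      using \<eta>(2)[of y x] \<eta>(1) that by (auto simp: dist_real_def dist_commute)
    also have "(\<kappa> - 1) * c \<le> (\<kappa> - 1) * \<Phi> x"
      using assms c by (intro mult_left_mono) auto
    finally show ?thesis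
      by (simp add: algebra_simps)
  qed
  have "sup_weight \<phi> F \<Phi> \<epsilon> n x \<le> \<kappa> * center_weight \<phi> F \<Phi> \<epsilon> n x"
    if \<epsilon>: "0 \<le> \<epsilon>" "\<epsilon> \<le> \<eta> / 2" and n: "1 \<le> n" for \<epsilon> n x
    unfolding sup_weight_def center_weight_def
  proof (rule cSUP_least)
    show "bowen_cball \<phi> (F n) x \<epsilon> \<noteq> {}"
      using mem_cball_self[OF n \<epsilon>(1)] by blast
    fix y assume "y \<in> bowen_cball \<phi> (F n) x \<epsilon>"
    then have "\<forall>g\<in>F n. dist (\<phi> g x) (\<phi> g y) \<le> \<epsilon>"
      using n by (simp add: bowen_cball_def bowen_dist_le_iff finite_F nonempty_F)
    then show "S n y \<le> \<kappa> * S n x"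
      unfolding orbit_sum_def sum_distrib_left using \<epsilon> by (intro sum_mono pot) force
  qed
  then show ?thesis
    using \<eta>(1) by (intro exI[of _ "\<eta> / 2"]) auto
qed

text \<open>The two weights differ by at most a factor \<open>\<kappa>\<close> for small radii, where \<open>\<kappa> > 1\<close> is arbitrary.\<close>

lemma BS_packing_dim_eq_center: "BS_packing_dim \<phi> F \<Phi> H = center_packing_dim H"
proof -
  let ?w = "sup_weight \<phi> F \<Phi>" and ?v = "center_weight \<phi> F \<Phi>"
  have ev1: "\<forall>\<^sub>F n in sequentially. (1::nat) \<le> n"
    by (rule eventually_ge_at_top)
  have dim: "BS_packing_dim \<phi> F \<Phi> H = (SUP \<epsilon>\<in>{0<..}. packing_critical \<phi> F ?w \<epsilon> H)"
    unfolding BS_packing_dim_def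
  proof (rule Lim_at_right_0_eq_SUP)
    fix a b :: real assume "0 < a" "a \<le> b"
    then show "packing_critical \<phi> F ?w b H \<le> packing_critical \<phi> F ?w a H"
      using packing_critical_le[of 1 a b H H ?w ?w \<phi> F] eventually_mono[OF ev1] sup_weight_mono
      by (simp add: less_imp_le)
  qed
  have "packing_critical \<phi> F ?w \<epsilon> H \<le> packing_critical \<phi> F ?v \<epsilon> H" if "0 < \<epsilon>" for \<epsilon>
    using packing_critical_le[of 1 \<epsilon> \<epsilon> H H ?v ?w \<phi> F] eventually_mono[OF ev1]
      center_weight_le_sup_weight that by (simp add: less_imp_le)
  then have "BS_packing_dim \<phi> F \<Phi> H \<le> center_packing_dim H"
    unfolding dim center_packing_dim_def by (intro SUP_subset_mono) auto
  moreover have "center_packing_dim H \<le> BS_packing_dim \<phi> F \<Phi> H"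
  proof (rule ennreal_le_if_le_mult)
    fix \<kappa> :: real assume "1 < \<kappa>"
    then obtain \<epsilon>0 where \<epsilon>0: "0 < \<epsilon>0"
      "\<And>\<epsilon> n x. 0 \<le> \<epsilon> \<Longrightarrow> \<epsilon> \<le> \<epsilon>0 \<Longrightarrow> 1 \<le> n \<Longrightarrow> ?w \<epsilon> n x \<le> \<kappa> * ?v \<epsilon> n x"
      using sup_weight_le_center_weight by blast
    show "center_packing_dim H \<le> ennreal \<kappa> * BS_packing_dim \<phi> F \<Phi> H"
      unfolding center_packing_dim_def
    proof (rule SUP_least)
      fix \<epsilon> :: real assume "\<epsilon> \<in> {0<..}"
      define \<epsilon>' where "\<epsilon>' = min \<epsilon> \<epsilon>0"
      have \<epsilon>': "0 < \<epsilon>'" "\<epsilon>' \<le> \<epsilon>" "\<epsilon>' \<le> \<epsilon>0"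
        using \<open>\<epsilon> \<in> {0<..}\<close> \<epsilon>0(1) by (auto simp: \<epsilon>'_def)
      have "packing_critical \<phi> F ?v \<epsilon> H \<le> packing_critical \<phi> F ?v \<epsilon>' H"
        using \<epsilon>' by (intro packing_critical_center_mono) auto
      also have "\<dots> \<le> ennreal \<kappa> * packing_critical \<phi> F ?w \<epsilon>' H"
      proof (rule packing_critical_le)
        show "\<forall>\<^sub>F n in sequentially. \<forall>x. ?w \<epsilon>' n x \<le> \<kappa> * ?v \<epsilon>' n x"
          using ev1 by eventually_elim (use \<epsilon>' \<epsilon>0(2) in \<open>simp add: less_imp_le\<close>)
      qed (use \<open>1 < \<kappa>\<close> in auto)
      also have "\<dots> \<le> ennreal \<kappa> * BS_packing_dim \<phi> F \<Phi> H"
        unfolding dim using \<epsilon>' by (intro mult_left_mono SUP_upper) auto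
      finally show "packing_critical \<phi> F ?v \<epsilon> H \<le> ennreal \<kappa> * BS_packing_dim \<phi> F \<Phi> H" .
    qed
  qed
  ultimately show ?thesis by (rule antisym)
qed

section \<open>The variational principle\<close>

lemma exists_measure_of_large_dimension:
  fixes f :: "'b::polish_space \<Rightarrow> 'x"
  assumes f: "continuous_on UNIV f" "range f = H" and less: "a < center_packing_dim H"
  shows "\<exists>\<mu>\<in>prob_measures_on H. a \<le> upper_BK_dim \<phi> F \<Phi> \<mu> \<and> a \<le> katok_packing_dim \<phi> F \<Phi> \<mu>"
proof -
  obtain \<epsilon> where "0 < \<epsilon>" "a < packing_critical \<phi> F (center_weight \<phi> F \<Phi>) \<epsilon> H"
    using less unfolding center_packing_dim_def by (auto simp: less_SUP_iff)
  then obtain t where t: "0 < t" "packing_outer \<phi> F (center_weight \<phi> F \<Phi>) t \<epsilon> H = \<infinity>" "a < ennreal t"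
    unfolding packing_critical_def less_Sup_iff by blast
  obtain b where b: "a = ennreal b" "0 \<le> b"
    using t(3) by (cases a) auto
  then have "b < t"
    using t by (simp add: ennreal_less_iff)
  \<comment> \<open>The gaps above \<open>s1\<close> are spent, in ascending order, on the Katok dimension, on the construction
    of the measure and on the packing quantity of \<open>sigma_bounded\<close> sets.\<close>
  then obtain s1 s2 s3 where s: "b < s1" "s1 < s2" "s2 < s3" "s3 < t"
    by (meson dense)
  have "\<not> sigma_bounded s3 \<epsilon> (range f)"
    using sigma_bounded_packing_outer_eq_0[of \<epsilon> s3 t H] t(2) s(4) \<open>0 < \<epsilon>\<close> f(2) by auto
  then obtain \<mu> K where \<mu>: "prob_space \<mu>" "sets \<mu> = sets borel"
    and K: "K \<in> sets borel" "K \<subseteq> H" "measure \<mu> K = 1"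
    and freq: "\<And>x. x \<in> K \<Longrightarrow>
      \<exists>\<^sub>F n in sequentially. measure \<mu> (B n x (\<epsilon> / 4)) \<le> exp (- s2 * S n x)"
    using frostman_measure[OF f(1) \<open>0 < \<epsilon>\<close> _ s(3)] f(2) s b(2) by auto
  have "ennreal s2 \<le> upper_BK_dim \<phi> F \<Phi> \<mu>"
    using \<open>0 < \<epsilon>\<close> s b freq by (intro upper_BK_dim_ge[OF \<mu> _ _ K(1,3), of "\<epsilon> / 4"]) auto
  moreover have "a \<le> ennreal s2"
    using s b by (auto intro: ennreal_leI)
  moreover have "ennreal s1 \<le> katok_packing_dim \<phi> F \<Phi> \<mu>"
    using \<open>0 < \<epsilon>\<close> s b freq
    by (intro katok_packing_dim_ge[OF \<mu> _ _ _ K(1,3), of "\<epsilon> / 12" s1 s2]) auto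
  moreover have "a \<le> ennreal s1"
    using s b by (auto intro: ennreal_leI)
  moreover have "\<mu> \<in> prob_measures_on H"
    using prob_measures_onI[OF \<mu> K(1,2,3)] .
  ultimately show ?thesis
    by (meson order_trans)
qed

lemma variational_principle:
  fixes f :: "'b::polish_space \<Rightarrow> 'x"
  assumes f: "continuous_on UNIV f" "range f = H"
  shows "(SUP \<mu>\<in>prob_measures_on H. upper_BK_dim \<phi> F \<Phi> \<mu>) = BS_packing_dim \<phi> F \<Phi> H"
    and "(SUP \<mu>\<in>prob_measures_on H. BS_packing_dim_measure \<phi> F \<Phi> \<mu>) = BS_packing_dim \<phi> F \<Phi> H"
    and "(SUP \<mu>\<in>prob_measures_on H. katok_packing_dim \<phi> F \<Phi> \<mu>) = BS_packing_dim \<phi> F \<Phi> H"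
proof -
  let ?D = "center_packing_dim H"
  let ?BK = "SUP \<mu>\<in>prob_measures_on H. upper_BK_dim \<phi> F \<Phi> \<mu>"
  let ?BS = "SUP \<mu>\<in>prob_measures_on H. BS_packing_dim_measure \<phi> F \<Phi> \<mu>"
  let ?KP = "SUP \<mu>\<in>prob_measures_on H. katok_packing_dim \<phi> F \<Phi> \<mu>"
  have "a \<le> ?BK" "a \<le> ?KP" if "a < ?D" for a
    using exists_measure_of_large_dimension[OF f that] by (auto intro: SUP_upper2)
  then have "?D \<le> ?BK" "?D \<le> ?KP"
    by (auto intro: dense_le)
  moreover have "?KP \<le> ?BS"
    by (intro SUP_mono' katok_packing_dim_le)
  moreover have "?BK \<le> ?D" "?BS \<le> ?D"
    by (auto intro!: SUP_least upper_BK_dim_le BS_packing_dim_measure_le)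
  ultimately show "?BK = BS_packing_dim \<phi> F \<Phi> H" "?BS = BS_packing_dim \<phi> F \<Phi> H"
    "?KP = BS_packing_dim \<phi> F \<Phi> H"
    unfolding BS_packing_dim_eq_center by order+
qed

end

section \<open>The Baire space as a Polish space\<close>

text \<open>Analytic sets are images of \<open>nat \<Rightarrow> nat\<close>; a complete metric on \<open>nat\<close> makes this product a Polish space.\<close>

instantiation nat :: metric_space
begin

definition dist_nat :: "nat \<Rightarrow> nat \<Rightarrow> real" where
  "dist_nat m n = \<bar>real m - real n\<bar>"

definition uniformity_nat :: "(nat \<times> nat) filter" where
  "uniformity_nat = (INF e\<in>{0<..}. principal {(x, y). dist x y < e})"

instance
proof
  show "uniformity = (INF e\<in>{0<..}. principal {(x :: nat, y). dist x y < e})"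
    by (rule uniformity_nat_def)
  show "open U \<longleftrightarrow> (\<forall>x\<in>U. \<forall>\<^sub>F (x', y) in uniformity. x' = x \<longrightarrow> y \<in> U)" for U :: "nat set"
  proof -
    have eq: "x = y" if "dist x y < 1" for x y :: nat
      using that unfolding dist_nat_def by linarith
    have "\<forall>\<^sub>F (x', y) in uniformity. x' = x \<longrightarrow> y \<in> U" if "x \<in> U" for x :: nat
      unfolding uniformity_nat_def
      by (rule eventually_INF1[of 1]) (use that eq in \<open>auto simp: eventually_principal\<close>)
    moreover have "open U"
      by (rule open_discrete)
    ultimately show ?thesis
      by blast
  qed
qed (auto simp: dist_nat_def)

end

instance nat :: complete_space
proof
  fix X :: "nat \<Rightarrow> nat" assume "Cauchy X"
  then obtain M where M: "\<And>m n. M \<le> m \<Longrightarrow> M \<le> n \<Longrightarrow> dist (X m) (X n) < 1"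
    using metric_CauchyD[of X 1] by auto
  have "X n = X M" if "M \<le> n" for n
    using M[OF that order_refl] by (simp add: dist_nat_def)
  then have "\<forall>\<^sub>F n in sequentially. X n = X M"
    by (rule eventually_sequentiallyI)
  then have "X \<longlonglongrightarrow> X M"
    by (rule tendsto_eventually)
  then show "convergent X"
    by (rule convergentI)
qed

instance nat :: polish_space ..

theorem theorem1p3:
  fixes G :: "('g, 'b) monoid_scheme"
    and \<phi> :: "'g \<Rightarrow> 'x::metric_space \<Rightarrow> 'x"
    and F :: "nat \<Rightarrow> 'g set"
    and H :: "'x set"
    and \<Phi> :: "'x \<Rightarrow> real"
  assumes "group G" and "countable (carrier G)" and "infinite (carrier G)"
    and "amenable_group G"
    and "compact (UNIV :: 'x set)"
    and "continuous_group_action G \<phi>"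
    and "folner_sequence G F"
    and "mono_on {1..} (\<lambda>n. card (F n))"
    and "filterlim (\<lambda>n. real (card (F n)) / ln (real n)) at_top sequentially"
    and "H \<noteq> {}" and "analytic_set H"
    and "continuous_on UNIV \<Phi>" and "\<And>x. \<Phi> x > 0"
  shows "BS_packing_dim \<phi> F \<Phi> H = (SUP \<mu>\<in>prob_measures_on H. upper_BK_dim \<phi> F \<Phi> \<mu>)
    \<and> (SUP \<mu>\<in>prob_measures_on H. upper_BK_dim \<phi> F \<Phi> \<mu>)
        = (SUP \<mu>\<in>prob_measures_on H. BS_packing_dim_measure \<phi> F \<Phi> \<mu>)
    \<and> (SUP \<mu>\<in>prob_measures_on H. BS_packing_dim_measure \<phi> F \<Phi> \<mu>)
        = (SUP \<mu>\<in>prob_measures_on H. katok_packing_dim \<phi> F \<Phi> \<mu>)"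
proof -
  have F: "finite (F n) \<and> F n \<noteq> {} \<and> F n \<subseteq> carrier G" if "1 \<le> n" for n
    using \<open>folner_sequence G F\<close> that by (simp add: folner_sequence_def)
  interpret bowen_packing \<phi> F \<Phi>
  proof
    show "continuous_on UNIV (\<phi> g)" if "1 \<le> n" "g \<in> F n" for n g
      using \<open>continuous_group_action G \<phi>\<close> F[OF that(1)] that(2)
      by (auto simp: continuous_group_action_def)
  qed (use assms F in auto)
  obtain f :: "(nat \<Rightarrow> nat) \<Rightarrow> 'x" where "continuous_on UNIV f" "range f = H"
    using \<open>H \<noteq> {}\<close> \<open>analytic_set H\<close> by (auto simp: analytic_set_def)
  from variational_principle[OF this] show ?thesis
    by simp
qed

end
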